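(* Let $n$ be an odd positive integer and let $p_0$ be the smallest prime not dividing $2n$. Then $$\lambda(Q_{4n})=\min\{16,\,p_0\}.$$ Explicitly: $\lambda(Q_{4n})=3$ if $3\nmid n$; $=5$ if $3\mid n$, $5\nmid n$; $=7$ if $15\mid n$, $7\nmid n$; $=11$ if $105\mid n$, $11\nmid n$; $=13$ if $1155\mid n$, $13\nmid n$; and $=16$ if $3\cdot5\cdot7\cdot11\cdot13\mid n$.
   Context: For a finite group $G=\{g_1,\dots,g_N\}$ assign an indeterminate $x_g$ to each $g\in G$; the group determinant $\mathscr D_G(x_{g_1},\dots,x_{g_N})$ is the determinant of the $N\times N$ matrix whose $(i,j)$ entry is $x_{g_ig_j^{-1}}$. Let $\mathcal S(G)=\{\mathscr D_G(x_{g_1},\dots,x_{g_N}) : x_{g_i}\in\mathbb Z\}$ and $\lambda(G)=\min\{|D| : D\in\mathcal S(G),\ |D|\ge 2\}$. $Q_{4n}=\langle x,y : x^{2n}=1,\ y^2=x^n,\ xy=yx^{-1}\rangle$ is the dicyclic group of order $4n$. *)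

theory Defs
  imports "HOL-Combinatorics.Permutations" "HOL-Computational_Algebra.Primes" "HOL-Algebra.Group"
begin

text \<open>Group determinant of a finite group G, with integer variables x g (g in the carrier):
  the determinant of the matrix with (g,h) entry x (g h^-1), written via the Leibniz formula
  over permutations of the carrier.\<close>
definition group_det :: "('a, 'b) monoid_scheme \<Rightarrow> ('a \<Rightarrow> int) \<Rightarrow> int" where
  "group_det G x =
     (\<Sum>\<sigma> \<in> {\<sigma>. \<sigma> permutes carrier G}.
        sign \<sigma> * (\<Prod>g \<in> carrier G. x (g \<otimes>\<^bsub>G\<^esub> inv\<^bsub>G\<^esub> (\<sigma> g))))"

definition int_group_dets :: "('a, 'b) monoid_scheme \<Rightarrow> int set" where
  "int_group_dets G = {group_det G x | x. True}"

definition lambda_grp :: "('a, 'b) monoid_scheme \<Rightarrow> nat" where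
  "lambda_grp G = (LEAST m::nat. 2 \<le> m \<and> (\<exists>D \<in> int_group_dets G. \<bar>D\<bar> = int m))"

text \<open>Dicyclic group Q_{4n}: the pair (a,b) stands for x^a y^b with 0 <= a < 2n, b in {0,1};
  using y x = x^-1 y and y^2 = x^n.\<close>
definition dicyclic_mult :: "nat \<Rightarrow> int \<times> int \<Rightarrow> int \<times> int \<Rightarrow> int \<times> int" where
  "dicyclic_mult n g h =
     ((fst g + (if snd g = 0 then fst h else - fst h)
         + (if snd g = 1 \<and> snd h = 1 then int n else 0)) mod (2 * int n),
      (snd g + snd h) mod 2)"

definition dicyclic :: "nat \<Rightarrow> (int \<times> int) monoid" where
  "dicyclic n = \<lparr> carrier = {0..<2 * int n} \<times> {0..1}, mult = dicyclic_mult n, one = (0, 0) \<rparr>"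

end

(*
  Block-diagonalizing the right regular representation writes the group determinant as the product
  of h(z) = f(z) f(1/z) - z^n g(z) g(1/z) over the 2n-th roots of unity z, with f, g arbitrary
  integer polynomials.  As n is odd this is E(P) E(Q), where E(P) is the product of P over the n-th
  roots of unity and P, Q are the restrictions of h to z = s and z = -s (s^n = 1), both invariant
  under s -> 1/s.

  Lower bound.  Pairing s with 1/s gives E(P) = P(1) A^2, where A is an integer because it is the
  determinant of an integer matrix that the sine matrix (s_j^i - s_j^(-i)) diagonalizes.  Since
  P = Q mod 2, an even determinant is divisible by 16.  If p is an odd prime with n = q m, q the
  power of p in n, then E_n(P) = E_m(P) B^2 with B an integer and, by Frobenius,
  B^(2q) = E_m(P)^(q-1) mod p.  So p divides E_m(P) iff it divides B, and p | E_n(P) forces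
  p^3 | E_n(P).  A determinant of absolute value between 2 and 15 therefore has a prime factor
  coprime to 2n.

  Upper bound.  f = 1 + x^2, g = 0 gives 16.  For p = 2k+1 coprime to n there are f, g with
  h(s) h(-s) = V(s) V(-s)^3, where V(s) = s^(-k) + ... + s^k = s^(-k) (s^p - 1)/(s - 1), and the
  product over all s telescopes to absolute value p.
*)
theory Submission
  imports "HOL-Number_Theory.Residues" "Jordan_Normal_Form.Char_Poly" Defs
begin

section \<open>Roots of unity and determinants\<close>

text \<open>Conjugating a permutation by the enumeration \<open>f\<close> preserves its sign. So the
  Leibniz sum over permutations of a group, as in \<open>group_det\<close>, becomes the determinant
  of an ordinary numbered matrix.\<close>

lemma det_reindex:
  fixes x :: "'a \<Rightarrow> 'a \<Rightarrow> 'b :: comm_ring_1"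
  assumes f: "bij_betw f {0..<N} A"
  shows "(\<Sum>\<sigma> | \<sigma> permutes A. of_int (sign \<sigma>) * (\<Prod>g\<in>A. x g (\<sigma> g)))
       = det (mat N N (\<lambda>(i, j). x (f i) (f j)))"
proof -
  let ?m = "map_permutation {0..<N} f"
  have inj: "inj_on f {0..<N}" and im: "f ` {0..<N} = A"
    using f by (auto simp: bij_betw_def)
  have "bij_betw (\<lambda>\<pi> x. if x \<in> A then f (\<pi> (inv_into {0..<N} f x)) else x)
          {\<pi>. \<pi> permutes {0..<N}} {\<pi>. \<pi> permutes A}"
    by (rule bij_betw_permutations[OF f])
  moreover have "(\<lambda>\<pi> x. if x \<in> A then f (\<pi> (inv_into {0..<N} f x)) else x) = ?m"
    using im by (auto simp: map_permutation_def restrict_id_def fun_eq_iff)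
  ultimately have bij: "bij_betw ?m {\<pi>. \<pi> permutes {0..<N}} {\<pi>. \<pi> permutes A}"
    by simp
  have "(\<Sum>\<sigma> | \<sigma> permutes A. of_int (sign \<sigma>) * (\<Prod>g\<in>A. x g (\<sigma> g)))
      = (\<Sum>\<pi> | \<pi> permutes {0..<N}. of_int (sign (?m \<pi>)) * (\<Prod>g\<in>A. x g (?m \<pi> g)))"
    by (rule sum.reindex_bij_betw[OF bij, symmetric])
  also have "\<dots> = (\<Sum>\<pi> | \<pi> permutes {0..<N}. signof \<pi> * (\<Prod>i = 0..<N. x (f i) (f (\<pi> i))))"
  proof (rule sum.cong[OF refl])
    fix \<pi> assume "\<pi> \<in> {\<pi>. \<pi> permutes {0..<N}}"
    then have \<pi>: "\<pi> permutes {0..<N}" by simp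
    have "(\<Prod>g\<in>A. x g (?m \<pi> g)) = (\<Prod>i = 0..<N. x (f i) (?m \<pi> (f i)))"
      by (rule prod.reindex_bij_betw[OF f, symmetric])
    also have "\<dots> = (\<Prod>i = 0..<N. x (f i) (f (\<pi> i)))"
      by (rule prod.cong) (use inj in \<open>auto simp: map_permutation_apply\<close>)
    finally show "of_int (sign (?m \<pi>)) * (\<Prod>g\<in>A. x g (?m \<pi> g))
        = signof \<pi> * (\<Prod>i = 0..<N. x (f i) (f (\<pi> i)))"
      using sign_map_permutation[OF inj \<pi>] by simp
  qed
  also have "\<dots> = det (mat N N (\<lambda>(i, j). x (f i) (f j)))"
    unfolding det_def
    by (auto intro!: sum.cong prod.cong simp: permutes_in_image)
  finally show ?thesis .
qed

section \<open>Periodic sums and roots of unity\<close>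

lemma sum_periodic_reindex:
  fixes \<psi> :: "int \<Rightarrow> 'a :: comm_monoid_add"
  assumes N: "N > 0" and per: "\<And>k. \<psi> (k mod int N) = \<psi> k" and e: "e = 1 \<or> e = -1"
  shows "(\<Sum>k<N. \<psi> (c + e * int k)) = (\<Sum>k<N. \<psi> (int k))"
proof -
  have *: "(\<Sum>k<N. h (int k)) = (\<Sum>k\<in>{0..<int N}. h k)" for h :: "int \<Rightarrow> 'a"
    by (rule sum.reindex_bij_witness[of _ nat int]) auto
  have ee: "e * e = 1" using e by auto
  have "(\<Sum>k\<in>{0..<int N}. \<psi> (c + e * k)) = (\<Sum>k\<in>{0..<int N}. \<psi> k)"
  \<comment> \<open>Since \<open>e * e = 1\<close>, the map k -> e(k - c) inverts k -> c + ek on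
    residues mod N.\<close>
  proof (rule sum.reindex_bij_witness[of _ "\<lambda>k. (e * (k - c)) mod int N" "\<lambda>k. (c + e * k) mod int N"])
    fix k assume k: "k \<in> {0..<int N}"
    have "(e * ((c + e * k) mod int N - c)) mod int N = (e * ((c + e * k) - c)) mod int N"
      by (metis mod_diff_left_eq mod_mult_right_eq)
    also have "e * ((c + e * k) - c) = (e * e) * k" by (simp add: algebra_simps)
    finally show "(e * ((c + e * k) mod int N - c)) mod int N = k" using k ee by simp
    have "(c + e * ((e * (k - c)) mod int N)) mod int N = (c + e * (e * (k - c))) mod int N"
      by (metis mod_add_right_eq mod_mult_right_eq)
    also have "c + e * (e * (k - c)) = c + (e * e) * (k - c)" by (simp add: algebra_simps)
    finally show "(c + e * ((e * (k - c)) mod int N)) mod int N = k" using k ee by simp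
  qed (use N per in auto)
  then show ?thesis by (simp add: *[of "\<lambda>k. \<psi> (c + e * k)"] *[of \<psi>])
qed

lemma powi_mod_root:
  fixes z :: complex
  assumes "z ^ N = 1" "N > 0"
  shows "z powi (k mod int N) = z powi k"
proof -
  have z: "z \<noteq> 0" using assms by (auto simp: power_0_left)
  have "z powi k = z powi (int N * (k div int N) + k mod int N)" by simp
  also have "\<dots> = (z powi int N) powi (k div int N) * z powi (k mod int N)"
    using z by (simp only: power_int_add power_int_mult simp_thms)
  also have "z powi int N = 1" using assms by simp
  finally show ?thesis by simp
qed

lemma sum_powers_root:
  fixes z :: complex
  assumes "z ^ N = 1"
  shows "(\<Sum>k<N. z ^ k) = (if z = 1 then of_nat N else 0)"
  using assms by (simp add: geometric_sum)

definition unity :: "nat \<Rightarrow> complex" where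
  "unity N = cis (2 * pi / real N)"

lemma unity_power: "N > 0 \<Longrightarrow> unity N ^ N = 1"
  by (simp add: unity_def DeMoivre)

lemma unity_nonzero [simp]: "unity N \<noteq> 0"
  by (simp add: unity_def)

lemma bij_betw_unity:
  assumes "N > 0"
  shows "bij_betw (\<lambda>j. unity N ^ j) {..<N} {z. z ^ N = 1}"
proof -
  have "(\<lambda>j. unity N ^ j) = (\<lambda>k. cis (2 * pi * real k / real N))"
    by (auto simp: unity_def DeMoivre mult_ac)
  then show ?thesis using bij_betw_roots_unity[OF assms] by simp
qed

lemma unity_power_eq_1_iff:
  assumes "N > 0"
  shows "unity N ^ j = 1 \<longleftrightarrow> N dvd j"
proof -
  have "unity N ^ j = unity N ^ (j mod N + N * (j div N))" by simp
  also have "\<dots> = unity N ^ (j mod N)"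
    using unity_power[OF assms] by (simp only: power_add power_mult) simp
  finally have "unity N ^ j = unity N ^ (j mod N)" .
  moreover have "unity N ^ (j mod N) = unity N ^ 0 \<longleftrightarrow> j mod N = 0"
    using inj_on_eq_iff[OF bij_betw_imp_inj_on[OF bij_betw_unity[OF assms]], of "j mod N" 0] assms
    by auto
  ultimately show ?thesis by (simp add: dvd_eq_mod_eq_0)
qed

lemma unity_powi_eq_1_iff:
  assumes "N > 0"
  shows "unity N powi j = 1 \<longleftrightarrow> int N dvd j"
proof (cases "j \<ge> 0")
  case True
  then show ?thesis using unity_power_eq_1_iff[OF assms, of "nat j"]
    by (simp add: power_int_def int_dvd_int_iff[symmetric])
next
  case False
  then show ?thesis using unity_power_eq_1_iff[OF assms, of "nat (- j)"]
    by (simp add: power_int_def int_dvd_int_iff[symmetric] power_inverse)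
qed

lemma sum_unity_powi:
  assumes "N > 0"
  shows "(\<Sum>k<N. unity N powi (int k * c)) = (if int N dvd c then of_nat N else 0)"
proof -
  have "(\<Sum>k<N. unity N powi (int k * c)) = (\<Sum>k<N. (unity N powi c) ^ k)"
    by (rule sum.cong) (auto simp: mult.commute[of _ c] power_int_mult)
  moreover have "(unity N powi c) ^ N = 1"
    using unity_powi_eq_1_iff[OF assms, of "c * int N"] by (simp add: power_int_mult)
  ultimately show ?thesis
    using sum_powers_root[of "unity N powi c" N] unity_powi_eq_1_iff[OF assms, of c] by simp
qed

section \<open>Diagonal and block matrices\<close>

lemma index_mult_mat_sum:
  assumes "A \<in> carrier_mat n m" "B \<in> carrier_mat m k" "i < n" "j < k"
  shows "(A * B) $$ (i, j) = (\<Sum>c<m. A $$ (i, c) * B $$ (c, j))"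
  using assms by (auto simp: scalar_prod_def atLeast0LessThan intro!: sum.cong)

lemma four_block_mult_diag:
  assumes "A \<in> carrier_mat N N" "B \<in> carrier_mat N N" "C \<in> carrier_mat N N" "D \<in> carrier_mat N N"
    "V \<in> carrier_mat N N" "W \<in> carrier_mat N N"
  shows "four_block_mat A B C D * four_block_mat V (0\<^sub>m N N) (0\<^sub>m N N) W
       = four_block_mat (A * V) (B * W) (C * V) (D * W :: 'a :: comm_ring_1 mat)"
  using assms by (subst mult_four_block_mat[of _ N N _ N _ N _ _ N _ N]) auto

lemma diag_mult_four_block:
  assumes "A \<in> carrier_mat N N" "B \<in> carrier_mat N N" "C \<in> carrier_mat N N" "D \<in> carrier_mat N N"
    "V \<in> carrier_mat N N" "W \<in> carrier_mat N N"
  shows "four_block_mat V (0\<^sub>m N N) (0\<^sub>m N N) W * four_block_mat A B C D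
       = four_block_mat (V * A) (V * B) (W * C) (W * D :: 'a :: comm_ring_1 mat)"
  using assms by (subst mult_four_block_mat[of _ N N _ N _ N _ _ N _ N]) auto

lemma det_diagonal_entries:
  "det (mat N N (\<lambda>(i, j). if i = j then d j else 0)) = (\<Prod>j<N. d j :: 'a :: idom)"
proof -
  let ?A = "mat N N (\<lambda>(i, j). if i = j then d j else 0)"
  have "det ?A = prod_list (diag_mat ?A)"
    by (rule det_upper_triangular[of _ N]) auto
  also have "diag_mat ?A = map d [0..<N]"
    by (auto simp: diag_mat_def)
  also have "prod_list \<dots> = (\<Prod>j<N. d j)"
    by (simp add: prod.distinct_set_conv_list[symmetric] atLeast0LessThan)
  finally show ?thesis .
qed

lemma diagonal_mult:
  "mat N N (\<lambda>(i, j). if i = j then a j else 0) * mat N N (\<lambda>(i, j). if i = j then b j else 0)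
     = mat N N (\<lambda>(i, j). if i = j then a j * b j else (0 :: 'a :: comm_ring_1))" (is "?A * ?B = ?C")
proof (rule eq_matI)
  fix i j assume "i < dim_row ?C" "j < dim_col ?C"
  then have ij: "i < N" "j < N" by auto
  have "(?A * ?B) $$ (i, j) = (\<Sum>c<N. ?A $$ (i, c) * ?B $$ (c, j))"
    by (rule index_mult_mat_sum) (auto simp: ij)
  also have "\<dots> = (\<Sum>c<N. if c = j then (if i = j then a j * b j else 0) else 0)"
  proof (rule sum.cong[OF refl])
    fix c assume "c \<in> {..<N}"
    then have "?A $$ (i, c) = (if i = c then a c else 0)" "?B $$ (c, j) = (if c = j then b j else 0)"
      using ij by simp_all
    then show "?A $$ (i, c) * ?B $$ (c, j) = (if c = j then (if i = j then a j * b j else 0) else 0)"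
      by (cases "c = j") simp_all
  qed
  also have "\<dots> = (if i = j then a j * b j else 0)"
    using ij by (subst sum.delta) simp_all
  also have "\<dots> = ?C $$ (i, j)"
    using ij by simp
  finally show "(?A * ?B) $$ (i, j) = ?C $$ (i, j)" .
qed (simp_all)

text \<open>Substituting k = a + ec shows that a row of a circulant (e = -1) or a Hankel matrix (e =
  1), applied to the vector of powers of z^d, gives a power of z times a Fourier sum that does not
  depend on the row index a. This is the eigenvector computation behind all the diagonalizations
  below.\<close>

lemma sum_twisted:
  fixes \<phi> :: "int \<Rightarrow> complex"
  assumes N: "N > 0" and per: "\<And>k. \<phi> (k mod int N) = \<phi> k" and z: "z ^ N = 1"
    and e: "e = 1 \<or> e = -1" and d: "d = 1 \<or> d = -1"
  shows "(\<Sum>c<N. \<phi> (a + e * int c) * z powi (d * int c))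
       = z powi (- d * e * a) * (\<Sum>k<N. \<phi> (int k) * (z powi (d * e)) ^ k)"
proof -
  have z0: "z \<noteq> 0" using N z by (auto simp: power_0_left)
  \<comment> \<open>The summand in terms of k = a + ec: then c = e(k - a), which gives the
    exponent.\<close>
  define \<psi> where "\<psi> k = \<phi> k * z powi (d * e * (k - a))" for k
  have "\<psi> (k mod int N) = \<psi> k" for k
  proof -
    have "z powi (d * e * (k mod int N - a)) = z powi ((d * e * (k mod int N - a)) mod int N)"
      by (rule powi_mod_root[OF z N, symmetric])
    also have "(d * e * (k mod int N - a)) mod int N = (d * e * (k - a)) mod int N"
      by (metis mod_diff_left_eq mod_mult_right_eq)
    also have "z powi \<dots> = z powi (d * e * (k - a))" by (rule powi_mod_root[OF z N])
    finally show ?thesis by (simp add: \<psi>_def per)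
  qed
  from sum_periodic_reindex[where \<psi> = \<psi> and c = a, OF N this e]
  have "(\<Sum>k<N. \<psi> (a + e * int k)) = (\<Sum>k<N. \<psi> (int k))" .
  moreover have "\<psi> (a + e * int k) = \<phi> (a + e * int k) * z powi (d * int k)" for k
  proof -
    have "d * e * (a + e * int k - a) = d * (e * e) * int k" by (simp add: algebra_simps)
    then show ?thesis using e by (auto simp: \<psi>_def)
  qed
  moreover have "\<psi> (int k) = z powi (- d * e * a) * (\<phi> (int k) * (z powi (d * e)) ^ k)" for k
  proof -
    have "d * e * (int k - a) = - d * e * a + d * e * int k" by (simp add: algebra_simps)
    then have "z powi (d * e * (int k - a)) = z powi (- d * e * a) * z powi (d * e * int k)"
      using z0 by (simp only: power_int_add simp_thms)
    then show ?thesis by (simp add: \<psi>_def power_int_mult)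
  qed
  ultimately show ?thesis by (simp add: sum_distrib_left)
qed

section \<open>Diagonalizing circulant and Hankel blocks\<close>

definition fourier :: "nat \<Rightarrow> (int \<Rightarrow> complex) \<Rightarrow> complex \<Rightarrow> complex" where
  "fourier N \<phi> z = (\<Sum>k<N. \<phi> (int k) * z ^ k)"

text \<open>By orthogonality of the characters, the matrices for d and -d multiply to N times the
  identity.\<close>

lemma det_dft_nonzero:
  assumes N: "N > 0" and d: "d = 1 \<or> d = -1"
  shows "det (mat N N (\<lambda>(i, j). unity N powi (d * int i * int j))) \<noteq> 0"
proof -
  let ?W = "\<lambda>d. mat N N (\<lambda>(i, j). unity N powi (d * int i * int j))"
  have "?W d * ?W (- d) = of_nat N \<cdot>\<^sub>m 1\<^sub>m N"
  proof (rule eq_matI)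
    fix i j assume "i < dim_row (of_nat N \<cdot>\<^sub>m 1\<^sub>m N :: complex mat)" "j < dim_col (of_nat N \<cdot>\<^sub>m 1\<^sub>m N :: complex mat)"
    then have ij: "i < N" "j < N" by auto
    have "(?W d * ?W (- d)) $$ (i, j)
        = (\<Sum>k<N. unity N powi (d * int i * int k) * unity N powi (- d * int k * int j))"
      using ij by (subst index_mult_mat_sum[of _ N N _ N]) auto
    also have "\<dots> = (\<Sum>k<N. unity N powi (int k * (d * (int i - int j))))"
      by (rule sum.cong) (auto simp: power_int_add[symmetric] algebra_simps)
    also have "\<dots> = (if int N dvd d * (int i - int j) then of_nat N else 0)"
      by (rule sum_unity_powi[OF N])
    also have "int N dvd d * (int i - int j) \<longleftrightarrow> i = j"
    proof -
      have "int N dvd d * (int i - int j) \<longleftrightarrow> int N dvd int i - int j" 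
        using d by (auto simp: dvd_diff_commute)
      also have "\<dots> \<longleftrightarrow> i = j" using ij zdvd_imp_le[of "int N" "int i - int j"] zdvd_imp_le[of "int N" "int j - int i"]
        by (cases "i < j"; cases "i = j") (auto simp: dvd_diff_commute)
      finally show ?thesis .
    qed
    finally show "(?W d * ?W (- d)) $$ (i, j) = (of_nat N \<cdot>\<^sub>m 1\<^sub>m N) $$ (i, j)"
      using ij by simp
  qed auto
  then have "det (?W d) * det (?W (- d)) = det (of_nat N \<cdot>\<^sub>m 1\<^sub>m N :: complex mat)"
    using det_mult[of "?W d" N "?W (- d)"] by simp
  also have "\<dots> \<noteq> 0" using N by (simp)
  finally show ?thesis by auto
qed

text \<open>A circulant block keeps the character c -> z^c, while a Hankel block exchanges it with c
  -> z^(-c). Hence one half of the coordinates is transformed by \<open>?W 1\<close> and the other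
  by \<open>?W (- 1)\<close>: in this basis all four blocks become diagonal at once, and the
  determinant splits into one 2 by 2 determinant for each z.\<close>

lemma det_circulant_hankel_blocks:
  fixes \<phi> \<gamma> :: "int \<Rightarrow> complex"
  assumes N: "N > 0"
    and \<phi>: "\<And>k. \<phi> (k mod int N) = \<phi> k" and \<gamma>: "\<And>k. \<gamma> (k mod int N) = \<gamma> k"
  shows "det (four_block_mat (mat N N (\<lambda>(a, c). \<phi> (int a - int c)))
                 (mat N N (\<lambda>(a, c). \<gamma> (int a + int c + int m)))
                 (mat N N (\<lambda>(a, c). \<gamma> (int a + int c)))
                 (mat N N (\<lambda>(a, c). \<phi> (int a - int c))))
       = (\<Prod>z | z ^ N = 1. fourier N \<phi> z * fourier N \<phi> (inverse z)
                            - z ^ m * (fourier N \<gamma> z * fourier N \<gamma> (inverse z)))"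
    (is "det (four_block_mat ?F ?G' ?G ?F) = _")
proof -
  let ?W = "\<lambda>d. mat N N (\<lambda>(i, j). unity N powi (d * int i * int j))"
  let ?D = "\<lambda>u :: complex \<Rightarrow> complex. mat N N (\<lambda>(i, j). if i = j then u (unity N ^ j) else 0)"
  have uN: "(unity N ^ j) ^ N = 1" for j
    by (metis unity_power[OF N] mult.commute power_mult power_one)
  have upow: "unity N powi (d * int i * int j) = (unity N ^ j) powi (d * int i)" for d i j
    by (simp add: power_int_mult[symmetric] power_int_power mult_ac)
  have D1: "?W d * ?D u = mat N N (\<lambda>(i, j). (unity N ^ j) powi (d * int i) * u (unity N ^ j))" for d u
  proof (rule eq_matI, goal_cases)
    case (1 i j)
    then have ij: "i < N" "j < N" by auto
    have "(?W d * ?D u) $$ (i, j) = (\<Sum>c<N. (unity N ^ c) powi (d * int i) * (if c = j then u (unity N ^ j) else 0))"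
      using ij by (subst index_mult_mat_sum[of _ N N _ N]) (auto simp: upow intro!: sum.cong)
    also have "\<dots> = (\<Sum>c<N. if c = j then (unity N ^ c) powi (d * int i) * u (unity N ^ j) else 0)"
      by (rule sum.cong) auto
    also have "\<dots> = (unity N ^ j) powi (d * int i) * u (unity N ^ j)"
      using ij by (subst sum.delta) auto
    finally show ?case using ij by simp
  qed auto
  \<comment> \<open>One formula serves all four products: e tells circulant from Hankel, d selects
    the matrix \<open>?W d\<close>, and t is the shift by m in the upper right block.\<close>
  have eig: "mat N N (\<lambda>(a, c). \<psi> (s * int a + e * int c + t)) * ?W d
       = mat N N (\<lambda>(i, j). (unity N ^ j) powi (- d * e * s * int i) *
            ((unity N ^ j) powi (- d * e * t) * fourier N \<psi> ((unity N ^ j) powi (d * e))))"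
    if \<psi>: "\<And>k. \<psi> (k mod int N) = \<psi> k" and e: "e = 1 \<or> e = -1" and d: "d = 1 \<or> d = -1"
    for \<psi> s e t d
  proof (rule eq_matI, goal_cases)
    case (1 i j)
    then have ij: "i < N" "j < N" by auto
    have "(mat N N (\<lambda>(a, c). \<psi> (s * int a + e * int c + t)) * ?W d) $$ (i, j)
        = (\<Sum>c<N. \<psi> ((s * int i + t) + e * int c) * (unity N ^ j) powi (d * int c))"
      using ij by (subst index_mult_mat_sum[of _ N N _ N]) (auto simp: upow add_ac intro!: sum.cong)
    also have "\<dots> = (unity N ^ j) powi (- d * e * (s * int i + t)) * fourier N \<psi> ((unity N ^ j) powi (d * e))"
      unfolding fourier_def by (rule sum_twisted) (use N \<psi> uN e d in auto)
    also have "- d * e * (s * int i + t) = (- d * e * s * int i) + (- d * e * t)"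
      by (simp add: algebra_simps)
    also have "(unity N ^ j) powi \<dots> = (unity N ^ j) powi (- d * e * s * int i) * (unity N ^ j) powi (- d * e * t)"
      by (subst power_int_add) auto
    finally show ?case using ij by (simp add: mult.assoc)
  qed auto
  have FW: "?F * ?W 1 = ?W 1 * ?D (\<lambda>z. fourier N \<phi> (inverse z))"
    unfolding D1[of 1 "\<lambda>z. fourier N \<phi> (inverse z)"] using eig[of \<phi> "-1" 1 1 0, OF \<phi>] by simp
  have FW': "?F * ?W (- 1) = ?W (- 1) * ?D (fourier N \<phi>)"
    unfolding D1 using eig[of \<phi> "-1" "-1" 1 0, OF \<phi>] by simp
  have GW: "?G * ?W 1 = ?W (- 1) * ?D (fourier N \<gamma>)"
    unfolding D1 using eig[of \<gamma> 1 1 1 0, OF \<gamma>] by simp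
  have G'W: "?G' * ?W (- 1) = ?W 1 * ?D (\<lambda>z. z ^ m * fourier N \<gamma> (inverse z))"
    unfolding D1[of 1 "\<lambda>z. z ^ m * fourier N \<gamma> (inverse z)"] using eig[of \<gamma> 1 "-1" 1 "int m", OF \<gamma>] by simp
  let ?E = "four_block_mat (?D (\<lambda>z. fourier N \<phi> (inverse z))) (?D (\<lambda>z. z ^ m * fourier N \<gamma> (inverse z)))
              (?D (fourier N \<gamma>)) (?D (fourier N \<phi>))"
  let ?V = "four_block_mat (?W 1) (0\<^sub>m N N) (0\<^sub>m N N) (?W (- 1))"
  let ?M = "four_block_mat ?F ?G' ?G ?F"
  have MV: "?M * ?V = ?V * ?E"
    by (subst four_block_mult_diag[of _ N], (simp; fail)+,
        subst diag_mult_four_block[of _ N], (simp; fail)+, simp only: FW FW' GW G'W)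
  have cM: "?M \<in> carrier_mat (N + N) (N + N)" and cV: "?V \<in> carrier_mat (N + N) (N + N)"
    and cE: "?E \<in> carrier_mat (N + N) (N + N)" by auto
  have "det ?V = det (?W 1) * det (?W (- 1))"
    by (rule det_four_block_mat_lower_left_zero[of _ N _ N]) auto
  then have V0: "det ?V \<noteq> 0" using det_dft_nonzero[OF N, of 1] det_dft_nonzero[OF N, of "-1"] by simp
  have DD: "?D u * ?D v = ?D (\<lambda>z. u z * v z)" for u v
    by (rule diagonal_mult)
  have "det ?V * det ?M = det ?V * det ?E"
    by (simp only: mult.commute[of "det ?V" "det ?M"] det_mult[OF cM cV, symmetric]
          det_mult[OF cV cE, symmetric] MV)
  then have "det ?M = det ?E" by (rule mult_left_cancel[OF V0, THEN iffD1])
  \<comment> \<open>Diagonal blocks commute, so the block determinant is that of AD - BC.\<close>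
  also have "det ?E = det (?D (\<lambda>z. fourier N \<phi> (inverse z)) * ?D (fourier N \<phi>)
          - ?D (\<lambda>z. z ^ m * fourier N \<gamma> (inverse z)) * ?D (fourier N \<gamma>))"
  proof (rule det_four_block_mat[of _ N])
    show "?D (fourier N \<gamma>) * ?D (fourier N \<phi>) = ?D (fourier N \<phi>) * ?D (fourier N \<gamma>)"
      unfolding DD[of "fourier N \<gamma>" "fourier N \<phi>"] DD[of "fourier N \<phi>" "fourier N \<gamma>"]
      by (simp only: mult.commute)
  qed simp_all
  also have "\<dots> = det (?D (\<lambda>z. fourier N \<phi> z * fourier N \<phi> (inverse z)
        - z ^ m * (fourier N \<gamma> z * fourier N \<gamma> (inverse z))))"
    unfolding DD[of "\<lambda>z. fourier N \<phi> (inverse z)" "fourier N \<phi>"]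
      DD[of "\<lambda>z. z ^ m * fourier N \<gamma> (inverse z)" "fourier N \<gamma>"]
    by (rule arg_cong[of _ _ det], rule eq_matI) (simp_all add: mult.commute)
  also have "\<dots> = (\<Prod>j<N. fourier N \<phi> (unity N ^ j) * fourier N \<phi> (inverse (unity N ^ j))
        - (unity N ^ j) ^ m * (fourier N \<gamma> (unity N ^ j) * fourier N \<gamma> (inverse (unity N ^ j))))"
    by (rule det_diagonal_entries)
  also have "\<dots> = (\<Prod>z | z ^ N = 1. fourier N \<phi> z * fourier N \<phi> (inverse z)
                            - z ^ m * (fourier N \<gamma> z * fourier N \<gamma> (inverse z)))"
    by (rule prod.reindex_bij_betw[OF bij_betw_unity[OF N]])
  finally show ?thesis .
qed

section \<open>The group determinant of the dicyclic group\<close>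

lemma dicyclic_simps:
  "carrier (dicyclic n) = {0..<2 * int n} \<times> {0..1}"
  "g \<otimes>\<^bsub>dicyclic n\<^esub> h = dicyclic_mult n g h"
  "\<one>\<^bsub>dicyclic n\<^esub> = (0, 0)"
  by (auto simp: dicyclic_def)

lemma dicyclic_inv_rotation:
  assumes "0 \<le> c" "c < 2 * int n"
  shows "inv\<^bsub>dicyclic n\<^esub> (c, 0) = ((- c) mod (2 * int n), 0)"
  unfolding m_inv_def
proof (rule the_equality, goal_cases)
  case 1
  then show ?case using assms
    by (auto simp: dicyclic_simps dicyclic_mult_def mod_simps)
next
  case (2 y)
  then obtain a b where y: "y = (a, b)" "0 \<le> a" "a < 2 * int n" "b = 0 \<or> b = 1"
    by (cases y) (fastforce simp: dicyclic_simps)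
  with 2 have "(c + a) mod (2 * int n) = 0" "b = 0"
    by (auto simp: dicyclic_simps dicyclic_mult_def)
  then have "(- c) mod (2 * int n) = a"
    using y by (metis add_diff_cancel_left' diff_0 mod_0 mod_diff_left_eq mod_pos_pos_trivial)
  then show ?case using y \<open>b = 0\<close> by simp
qed

text \<open>Since (x^c y)^2 = y^2 = x^n, and x^n is central of order 2, the inverse of x^c y is
  x^(c+n) y. As \<open>m_inv\<close> is a definite description, both existence and uniqueness are
  checked.\<close>

lemma dicyclic_inv_reflection:
  assumes "0 \<le> c" "c < 2 * int n"
  shows "inv\<^bsub>dicyclic n\<^esub> (c, 1) = ((c + int n) mod (2 * int n), 1)"
  unfolding m_inv_def
proof (rule the_equality, goal_cases)
  case 1
  have "(c - (c + int n) mod (2 * int n) + int n) mod (2 * int n)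
      = (c + int n - (c + int n) mod (2 * int n)) mod (2 * int n)" by (simp add: algebra_simps)
  also have "\<dots> = 0" by (subst mod_diff_right_eq) simp
  finally have *: "(c - (c + int n) mod (2 * int n) + int n) mod (2 * int n) = 0" .
  have "((c + int n) mod (2 * int n) - c + int n) mod (2 * int n)
      = ((c + int n) mod (2 * int n) - (c - int n)) mod (2 * int n)" by (simp add: algebra_simps)
  also have "\<dots> = 0" by (subst mod_diff_left_eq) simp
  finally show ?case using assms *
    by (auto simp: dicyclic_simps dicyclic_mult_def)
next
  case (2 y)
  then obtain a b where y: "y = (a, b)" "0 \<le> a" "a < 2 * int n" "b = 0 \<or> b = 1"
    by (cases y) (fastforce simp: dicyclic_simps)
  with 2 have *: "(c - a + int n) mod (2 * int n) = 0" "b = 1"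
    by (auto simp: dicyclic_simps dicyclic_mult_def)
  have "(c + int n) mod (2 * int n) = ((c - a + int n) mod (2 * int n) + a) mod (2 * int n)"
    by (simp add: mod_simps algebra_simps)
  then have "(c + int n) mod (2 * int n) = a"
    using y * by simp
  then show ?case using y \<open>b = 1\<close> by simp
qed

text \<open>These quotients are the entries of the four blocks: equal types depend on a - c and give
  circulants, mixed types depend on a + c and give Hankel blocks. The shift by n in one of them
  comes from y^2 = x^n.\<close>

lemma dicyclic_quotients:
  assumes "0 \<le> a" "a < 2 * int n" "0 \<le> c" "c < 2 * int n"
  shows "(a, 0) \<otimes>\<^bsub>dicyclic n\<^esub> inv\<^bsub>dicyclic n\<^esub> (c, 0) = ((a - c) mod (2 * int n), 0)"
    "(a, 0) \<otimes>\<^bsub>dicyclic n\<^esub> inv\<^bsub>dicyclic n\<^esub> (c, 1) = ((a + c + int n) mod (2 * int n), 1)"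
    "(a, 1) \<otimes>\<^bsub>dicyclic n\<^esub> inv\<^bsub>dicyclic n\<^esub> (c, 0) = ((a + c) mod (2 * int n), 1)"
    "(a, 1) \<otimes>\<^bsub>dicyclic n\<^esub> inv\<^bsub>dicyclic n\<^esub> (c, 1) = ((a - c) mod (2 * int n), 0)"
proof -
  have "(a - (c + int n) mod (2 * int n) + int n) mod (2 * int n)
      = (a + int n - (c + int n) mod (2 * int n)) mod (2 * int n)" by (simp add: algebra_simps)
  also have "\<dots> = (a - c) mod (2 * int n)" by (subst mod_diff_right_eq) simp
  finally show
    "(a, 1) \<otimes>\<^bsub>dicyclic n\<^esub> inv\<^bsub>dicyclic n\<^esub> (c, 1) = ((a - c) mod (2 * int n), 0)"
    using assms by (simp add: dicyclic_simps dicyclic_mult_def dicyclic_inv_reflection)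
  have "(a - (- c) mod (2 * int n)) mod (2 * int n) = (a + c) mod (2 * int n)" by (subst mod_diff_right_eq) simp
  then show "(a, 1) \<otimes>\<^bsub>dicyclic n\<^esub> inv\<^bsub>dicyclic n\<^esub> (c, 0) = ((a + c) mod (2 * int n), 1)"
    using assms by (simp add: dicyclic_simps dicyclic_mult_def dicyclic_inv_rotation)
qed (use assms in \<open>simp_all add: dicyclic_simps dicyclic_mult_def
      dicyclic_inv_rotation dicyclic_inv_reflection mod_simps add.assoc\<close>)

lemma group_det_dicyclic:
  fixes x :: "int \<times> int \<Rightarrow> int"
  assumes n: "n > 0"
  defines "\<phi> \<equiv> \<lambda>k. complex_of_int (x (k mod int (2 * n), 0))"
    and "\<gamma> \<equiv> \<lambda>k. complex_of_int (x (k mod int (2 * n), 1))"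
  shows "complex_of_int (group_det (dicyclic n) x)
       = (\<Prod>z | z ^ (2 * n) = 1. fourier (2 * n) \<phi> z * fourier (2 * n) \<phi> (inverse z)
                            - z ^ n * (fourier (2 * n) \<gamma> z * fourier (2 * n) \<gamma> (inverse z)))"
proof -
  let ?N = "2 * n"
  \<comment> \<open>All rotations x^a come first, then all x^a y, so that the matrix has the block
    form of \<open>det_circulant_hankel_blocks\<close>.\<close>
  define f where "f i = (int (i mod ?N), int (i div ?N))" for i
  let ?A = "carrier (dicyclic n)"
  let ?y = "\<lambda>g h. x (g \<otimes>\<^bsub>dicyclic n\<^esub> inv\<^bsub>dicyclic n\<^esub> h)"
  have f: "bij_betw f {0..<?N + ?N} ?A"
  proof (rule bij_betw_byWitness[of _ "\<lambda>(a, b). nat a + ?N * nat b"])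
    show "f ` {0..<?N + ?N} \<subseteq> ?A"
      using n by (auto simp: f_def dicyclic_simps zmod_int zdiv_int[symmetric] less_mult_imp_div_less
         intro!: Suc_leI less_Suc_eq_le[THEN iffD1] )
    show "(\<lambda>(a, b). nat a + ?N * nat b) ` ?A \<subseteq> {0..<?N + ?N}"
    proof -
      have "nat a + ?N * nat b < ?N + ?N" if "0 \<le> a" "a < 2 * int n" "0 \<le> b" "b \<le> 1" for a b
        using that by (cases "b = 0"; cases "b = 1") auto
      then show ?thesis by (auto simp: dicyclic_simps)
    qed
  next
    show "\<forall>a'\<in>?A. f ((\<lambda>(a, b). nat a + ?N * nat b) a') = a'"
    proof -
      have "f (nat a + ?N * nat b) = (a, b)" if "0 \<le> a" "a < 2 * int n" "0 \<le> b" "b \<le> 1" for a b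
      proof -
        have "nat a < ?N" using that by auto
        then show ?thesis using that n by (simp add: f_def)
      qed
      then show ?thesis by (auto simp: dicyclic_simps)
    qed
  qed (auto simp: f_def simp flip: zmod_int zdiv_int)
  have "group_det (dicyclic n) x = det (mat (?N + ?N) (?N + ?N) (\<lambda>(i, j). ?y (f i) (f j)))"
    using det_reindex[OF f, of ?y] by (simp add: group_det_def)
  then have "complex_of_int (group_det (dicyclic n) x)
      = det (map_mat of_int (mat (?N + ?N) (?N + ?N) (\<lambda>(i, j). ?y (f i) (f j))))"
    by (simp only: of_int_hom.hom_det)
  also have "map_mat of_int (mat (?N + ?N) (?N + ?N) (\<lambda>(i, j). ?y (f i) (f j)))
    = four_block_mat (mat ?N ?N (\<lambda>(a, c). \<phi> (int a - int c)))
                 (mat ?N ?N (\<lambda>(a, c). \<gamma> (int a + int c + int n)))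
                 (mat ?N ?N (\<lambda>(a, c). \<gamma> (int a + int c)))
                 (mat ?N ?N (\<lambda>(a, c). \<phi> (int a - int c)))" (is "_ = ?B")
  proof (rule eq_matI)
    fix i j assume "i < dim_row ?B" "j < dim_col ?B"
    then have ij: "i < ?N + ?N" "j < ?N + ?N" by auto
    have lo: "f k = (int k, 0)" if "k < ?N" for k using that by (simp add: f_def)
    have hi: "f k = (int (k - ?N), 1)" if "\<not> k < ?N" "k < ?N + ?N" for k
    proof -
      have "k div ?N = 1" using that by (simp add: div_nat_eqI)
      then show ?thesis using that n by (simp add: f_def modulo_nat_def)
    qed
    show "map_mat of_int (mat (?N + ?N) (?N + ?N) (\<lambda>(i, j). ?y (f i) (f j))) $$ (i, j) = ?B $$ (i, j)"
      using ij by (cases "i < ?N"; cases "j < ?N")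
         (simp_all add: lo hi dicyclic_quotients \<phi>_def \<gamma>_def)
  qed auto
  also have "det ?B = (\<Prod>z | z ^ ?N = 1. fourier ?N \<phi> z * fourier ?N \<phi> (inverse z)
                            - z ^ n * (fourier ?N \<gamma> z * fourier ?N \<gamma> (inverse z)))"
    by (rule det_circulant_hankel_blocks) (use n in \<open>auto simp: \<phi>_def \<gamma>_def\<close>)
  finally show ?thesis .
qed

section \<open>Integer polynomials evaluated at roots of unity\<close>

definition ipoly :: "int poly \<Rightarrow> complex \<Rightarrow> complex" where
  "ipoly F z = poly (map_poly of_int F) z"

lemma ipoly_simps [simp]:
  "ipoly 0 z = 0" "ipoly 1 z = 1" "ipoly (pCons a F) z = of_int a + z * ipoly F z"
  "ipoly (F + G) z = ipoly F z + ipoly G z" "ipoly (F - G) z = ipoly F z - ipoly G z"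
  "ipoly (- F) z = - ipoly F z"
  "ipoly (F * G) z = ipoly F z * ipoly G z" "ipoly (F ^ k) z = ipoly F z ^ k"
  "ipoly (Polynomial.smult c F) z = of_int c * ipoly F z"
  "ipoly (monom c k) z = of_int c * z ^ k"
  "ipoly (pcompose F G) z = ipoly F (ipoly G z)"
  by (simp_all add: ipoly_def hom_distribs poly_monom poly_pcompose map_poly_pCons of_int_hom.map_poly_pcompose)

lemma ipoly_sum: "ipoly (\<Sum>i\<in>I. F i) z = (\<Sum>i\<in>I. ipoly (F i) z)"
  by (induction I rule: infinite_finite_induct) auto

lemma ipoly_prod: "ipoly (\<Prod>i\<in>I. F i) z = (\<Prod>i\<in>I. ipoly (F i) z)"
  by (induction I rule: infinite_finite_induct) auto

lemma ipoly_altdef: "ipoly F z = (\<Sum>i\<le>degree F. of_int (coeff F i) * z ^ i)"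
  by (simp add: ipoly_def poly_altdef)

lemma ipoly_1: "ipoly F 1 = of_int (poly F 1)"
  by (simp add: ipoly_altdef poly_altdef)

text \<open>On N-th roots of unity only exponents mod N matter, so \<open>u\<close> adds up the
  coefficients in each residue class.\<close>

lemma ipoly_fourier:
  assumes N: "N > 0"
  obtains u :: "int \<Rightarrow> int" where "\<And>z. z ^ N = 1 \<Longrightarrow>
    ipoly F z = fourier N (\<lambda>k. of_int (u (k mod int N))) z"
proof -
  define u where "u k = (\<Sum>i | i \<le> degree F \<and> int (i mod N) = k. coeff F i)" for k
  have "ipoly F z = fourier N (\<lambda>k. of_int (u (k mod int N))) z" if z: "z ^ N = 1" for z
  proof -
    have zm: "z ^ i = z ^ (i mod N)" for i
      by (metis mod_mult_div_eq mult_1_right power_add power_mult power_one z)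
    have "ipoly F z = (\<Sum>i\<le>degree F. of_int (coeff F i) * z ^ (i mod N))"
      by (subst ipoly_altdef, subst zm) simp
    also have "\<dots> = (\<Sum>k<N. \<Sum>i | i \<in> {..degree F} \<and> i mod N = k. of_int (coeff F i) * z ^ (i mod N))"
      by (rule sum.group[symmetric]) (use N in auto)
    also have "\<dots> = fourier N (\<lambda>k. of_int (u (k mod int N))) z"
      unfolding fourier_def u_def
      by (intro sum.cong refl) (auto simp: sum_distrib_right intro!: sum.cong)
    finally show ?thesis .
  qed
  then show ?thesis by (rule that)
qed

lemma int_group_dets_dicyclicE:
  assumes n: "n > 0" and "D \<in> int_group_dets (dicyclic n)"
  obtains F G where "complex_of_int D =
    (\<Prod>z | z ^ (2 * n) = 1. ipoly F z * ipoly F (inverse z) - z ^ n * (ipoly G z * ipoly G (inverse z)))"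
proof -
  obtain x where D: "D = group_det (dicyclic n) x" using assms by (auto simp: int_group_dets_def)
  define P where "P b = (\<Sum>k<2 * n. monom (x (int k, b)) k)" for b
  have "fourier (2 * n) (\<lambda>k. of_int (x (k mod int (2 * n), b))) = ipoly (P b)" for b
    by (rule ext) (auto simp: fourier_def P_def ipoly_sum intro!: sum.cong)
  then show ?thesis
    using that[of "P 0" "P 1"] unfolding D group_det_dicyclic[OF n] by metis
qed

text \<open>Because of the folding in \<open>ipoly_fourier\<close>, determinants can be constructed
  from polynomials of arbitrary degree.\<close>

lemma int_group_dets_dicyclic_exists:
  assumes n: "n > 0"
  shows "\<exists>D \<in> int_group_dets (dicyclic n). complex_of_int D =
    (\<Prod>z | z ^ (2 * n) = 1. ipoly F z * ipoly F (inverse z) - z ^ n * (ipoly G z * ipoly G (inverse z)))"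
proof -
  have N: "2 * n > 0" using n by simp
  obtain u where u: "\<And>z. z ^ (2 * n) = 1 \<Longrightarrow> ipoly F z = fourier (2 * n) (\<lambda>k. of_int (u (k mod int (2 * n)))) z"
    using ipoly_fourier[OF N] by blast
  obtain v where v: "\<And>z. z ^ (2 * n) = 1 \<Longrightarrow> ipoly G z = fourier (2 * n) (\<lambda>k. of_int (v (k mod int (2 * n)))) z"
    using ipoly_fourier[OF N] by blast
  define x where "x g = (if snd g = (0::int) then u (fst g) else v (fst g))" for g
  have "complex_of_int (group_det (dicyclic n) x) =
    (\<Prod>z | z ^ (2 * n) = 1. ipoly F z * ipoly F (inverse z) - z ^ n * (ipoly G z * ipoly G (inverse z)))"
    unfolding group_det_dicyclic[OF n]
    by (rule prod.cong) (auto simp: u v x_def power_inverse)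
  then show ?thesis by (auto simp: int_group_dets_def)
qed

section \<open>Integrality\<close>

text \<open>The value is an eigenvalue of an integer matrix, hence a root of a monic integer
  polynomial, and a rational algebraic integer is an integer. This is how divisibility in Z[x] is
  brought down to Z: the value of the quotient at \<open>unity n\<close> turns out to be
  rational.\<close>

lemma cyclotomic_integer_rational:
  assumes n: "n > 0" and rat: "ipoly F (unity n) \<in> \<rat>"
  shows "ipoly F (unity n) \<in> \<int>"
proof -
  let ?w = "unity n" and ?x = "ipoly F (unity n)"
  obtain u where u: "\<And>z. z ^ n = 1 \<Longrightarrow> ipoly F z = fourier n (\<lambda>k. of_int (u (k mod int n))) z"
    using ipoly_fourier[OF n] by blast
  let ?\<phi> = "\<lambda>k. complex_of_int (u (k mod int n))"
  \<comment> \<open>multiplication by x on the powers of the root of unity is a circulant integer matrix\<close>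
  define A where "A = mat n n (\<lambda>(a, c). u ((int c - int a) mod int n))"
  let ?A = "map_mat complex_of_int A"
  let ?v = "vec n (\<lambda>c. ?w ^ c)"
  have A: "A \<in> carrier_mat n n" by (simp add: A_def)
  have "eigenvector ?A ?v ?x"
    unfolding eigenvector_def
  proof (intro conjI)
    show "?v \<in> carrier_vec (dim_row ?A)" using A by simp
    have "?v $ 0 \<noteq> 0\<^sub>v n $ 0" using n by simp
    then show "?v \<noteq> 0\<^sub>v (dim_row ?A)" using A by (metis carrier_matD(1) index_map_mat(2))
    show "?A *\<^sub>v ?v = ?x \<cdot>\<^sub>v ?v"
    proof (rule eq_vecI)
      fix a assume "a < dim_vec (?x \<cdot>\<^sub>v ?v)"
      then have a: "a < n" by simp
      have "(?A *\<^sub>v ?v) $ a = (\<Sum>c<n. ?\<phi> (- int a + 1 * int c) * ?w powi (1 * int c))"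
        using a by (auto simp: A_def scalar_prod_def atLeast0LessThan intro!: sum.cong)
      also have "\<dots> = ?w powi (- 1 * 1 * - int a) * (\<Sum>k<n. ?\<phi> (int k) * (?w powi (1 * 1)) ^ k)"
        by (rule sum_twisted) (use n unity_power in auto)
      also have "\<dots> = ?w ^ a * ?x"
        using u[OF unity_power[OF n]] by (simp add: fourier_def)
      finally show "(?A *\<^sub>v ?v) $ a = (?x \<cdot>\<^sub>v ?v) $ a" using a by simp
    qed (use A in auto)
  qed
  then have "eigenvalue ?A ?x" by (auto simp: eigenvalue_def)
  then have "poly (char_poly ?A) ?x = 0"
    using eigenvalue_root_char_poly[of ?A n ?x] A by simp
  then have "poly (map_poly of_int (char_poly A)) ?x = 0"
    by (simp add: of_int_hom.char_poly_hom[OF A])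
  moreover have "lead_coeff (char_poly A) = 1"
    using degree_monic_char_poly[OF A] by auto
  ultimately have "algebraic_int ?x"
    unfolding algebraic_int_altdef_ipoly by blast
  then show ?thesis using rat by (rule rational_algebraic_int_is_int)
qed

section \<open>The sine matrix and products over half of the roots\<close>

lemma sum_even_fold:
  fixes \<chi> :: "int \<Rightarrow> complex"
  assumes per: "\<And>k. \<chi> (k mod int (2 * m + 1)) = \<chi> k" and even: "\<And>k. \<chi> (- k) = \<chi> k"
  shows "(\<Sum>k<2 * m + 1. \<chi> (int k)) = \<chi> 0 + 2 * (\<Sum>k<m. \<chi> (int (Suc k)))"
proof -
  have "(\<Sum>k<2 * m + 1. \<chi> (int k)) = \<chi> 0 + (\<Sum>k<m + m. \<chi> (int (Suc k)))"
    by (simp only: mult_2 Suc_eq_plus1[symmetric] sum.lessThan_Suc_shift) simp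
  also have "(\<Sum>k<m + m. \<chi> (int (Suc k))) = (\<Sum>k<m. \<chi> (int (Suc k))) + (\<Sum>k<m. \<chi> (int (Suc (m + k))))"
  proof -
    have "(\<Sum>k<m + r. \<chi> (int (Suc k))) = (\<Sum>k<m. \<chi> (int (Suc k))) + (\<Sum>k<r. \<chi> (int (Suc (m + k))))" for r
      by (induction r) (simp_all add: add.assoc)
    then show ?thesis .
  qed
  \<comment> \<open>Reversing the upper half matches the residue n - k with k, where n = 2m + 1, and
    evenness makes the two terms equal.\<close>
  also have "(\<Sum>k<m. \<chi> (int (Suc (m + k)))) = (\<Sum>k<m. \<chi> (int (Suc (m + (m - Suc k)))))"
    by (rule sum.nat_diff_reindex[symmetric])
  also have "\<dots> = (\<Sum>k<m. \<chi> (int (Suc k)))"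
  proof (rule sum.cong[OF refl])
    fix k assume "k \<in> {..<m}"
    then have "int (Suc (m + (m - Suc k))) = int (2 * m + 1) - int (Suc k)" by auto
    then have "\<chi> (int (Suc (m + (m - Suc k)))) = \<chi> ((int (2 * m + 1) - int (Suc k)) mod int (2 * m + 1))"
      by (simp only: per)
    also have "(int (2 * m + 1) - int (Suc k)) mod int (2 * m + 1) = (- int (Suc k)) mod int (2 * m + 1)"
      by (metis diff_0 mod_diff_left_eq mod_self)
    finally show "\<chi> (int (Suc (m + (m - Suc k)))) = \<chi> (int (Suc k))" by (simp only: per even)
  qed
  finally show ?thesis by simp
qed

lemma unity_powi_mod: "n > 0 \<Longrightarrow> unity n powi (a * (k mod int n)) = unity n powi (a * k)"
  by (metis powi_mod_root unity_power mod_mult_right_eq)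

context
  fixes m n :: nat
  assumes n: "n = 2 * m + 1"
begin

text \<open>Entry (i, j) belongs to the pair of indices i + 1, j + 1.\<close>

definition sine_mat :: "complex mat" where
  "sine_mat = mat m m (\<lambda>(i, j). unity n powi (int (Suc i) * int (Suc j)) - unity n powi (- int (Suc i) * int (Suc j)))"

lemma sine_mat_carrier: "sine_mat \<in> carrier_mat m m"
  by (simp add: sine_mat_def)

text \<open>Orthogonality of sines: the square of the matrix is -n times the identity. The summand
  is even in k and vanishes at k = 0, so a sum over 1..m is half of the sum over all residues, where
  \<open>sum_unity_powi\<close> applies.\<close>

lemma det_sine_mat: "det sine_mat \<noteq> 0"
proof -
  have n0: "n > 0" using n by simp
  let ?w = "unity n"
  have "sine_mat * sine_mat = (- of_nat n) \<cdot>\<^sub>m 1\<^sub>m m"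
  proof (rule eq_matI)
    fix i j assume "i < dim_row ((- of_nat n) \<cdot>\<^sub>m 1\<^sub>m m :: complex mat)" "j < dim_col ((- of_nat n) \<cdot>\<^sub>m 1\<^sub>m m :: complex mat)"
    then have ij: "i < m" "j < m" by auto
    let ?I = "int (Suc i)" and ?J = "int (Suc j)"
    define \<chi> where "\<chi> k = (?w powi (?I * k) - ?w powi (- ?I * k)) * (?w powi (?J * k) - ?w powi (- ?J * k))" for k
    have "(sine_mat * sine_mat) $$ (i, j) = (\<Sum>k<m. sine_mat $$ (i, k) * sine_mat $$ (k, j))"
      by (rule index_mult_mat_sum[OF sine_mat_carrier sine_mat_carrier ij])
    also have "\<dots> = (\<Sum>k<m. \<chi> (int (Suc k)))"
      by (rule sum.cong) (use ij in \<open>simp_all add: sine_mat_def \<chi>_def mult.commute del: of_nat_Suc\<close>)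
    finally have S: "(sine_mat * sine_mat) $$ (i, j) = (\<Sum>k<m. \<chi> (int (Suc k)))" .
    have "(\<Sum>k<n. \<chi> (int k)) = \<chi> 0 + 2 * (\<Sum>k<m. \<chi> (int (Suc k)))"
      unfolding n
    proof (rule sum_even_fold, unfold n[symmetric])
      show "\<chi> (k mod int n) = \<chi> k" for k
        unfolding \<chi>_def unity_powi_mod[OF n0] ..
      show "\<chi> (- k) = \<chi> k" for k
        by (simp add: \<chi>_def algebra_simps del: of_nat_Suc)
    qed
    then have 2: "2 * (sine_mat * sine_mat) $$ (i, j) = (\<Sum>k<n. \<chi> (int k))"
      by (simp add: S \<chi>_def)
    have "\<chi> k = ?w powi (k * (?I + ?J)) - ?w powi (k * (?I - ?J)) - ?w powi (k * (?J - ?I)) + ?w powi (k * (- ?I - ?J))" for k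
    proof -
      have "k * (?I + ?J) = ?I * k + ?J * k" "k * (?I - ?J) = ?I * k + - ?J * k"
        "k * (?J - ?I) = - ?I * k + ?J * k" "k * (- ?I - ?J) = - ?I * k + - ?J * k"
        by (simp_all add: algebra_simps del: of_nat_Suc)
      then show ?thesis
        unfolding \<chi>_def by (simp only: power_int_add unity_nonzero simp_thms) (simp only: algebra_simps)
    qed
    then have "2 * (sine_mat * sine_mat) $$ (i, j)
        = (if int n dvd ?I + ?J then of_nat n else 0) - (if int n dvd ?I - ?J then of_nat n else 0)
        - (if int n dvd ?J - ?I then of_nat n else 0) + (if int n dvd - ?I - ?J then of_nat n else 0)"
      unfolding 2 by (simp only: sum.distrib sum_subtractf sum_unity_powi[OF n0])
    \<comment> \<open>Here 2 <= I + J <= 2m < n.\<close>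
    moreover have "\<not> int n dvd ?I + ?J"
      using ij n by (intro notI, drule_tac zdvd_imp_le) auto
    moreover have "int n dvd ?I - ?J \<longleftrightarrow> i = j"
      using ij n zdvd_imp_le[of "int n" "?I - ?J"] zdvd_imp_le[of "int n" "?J - ?I"]
      by (cases "i < j"; cases "i = j") (auto simp: dvd_diff_commute)
    moreover have "int n dvd ?J - ?I \<longleftrightarrow> int n dvd ?I - ?J" by (rule dvd_diff_commute)
    moreover have "int n dvd - ?I - ?J \<longleftrightarrow> int n dvd ?I + ?J"
      by (metis dvd_minus_iff minus_add_distrib uminus_add_conv_diff add.commute)
    ultimately show "(sine_mat * sine_mat) $$ (i, j) = ((- of_nat n) \<cdot>\<^sub>m 1\<^sub>m m) $$ (i, j)"
      using ij by (cases "i = j") auto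
  qed (auto simp: sine_mat_def)
  then have "det sine_mat * det sine_mat = (- of_nat n) ^ m"
    using det_mult[OF sine_mat_carrier sine_mat_carrier] by simp
  also have "\<dots> \<noteq> 0" using n0 by simp
  finally show ?thesis by auto
qed

text \<open>Convolution with the coefficients of Q acts on the odd functions on Z/n. In the
  coordinates 1..m this is the integer matrix \<open>C\<close>, and the columns of
  \<open>sine_mat\<close> are eigenvectors of it with eigenvalues Q(w^j). Comparing determinants
  makes the product equal to det C.\<close>

lemma half_prod_Ints:
  assumes sym: "\<And>z. z ^ n = 1 \<Longrightarrow> ipoly Q (inverse z) = ipoly Q z"
  shows "(\<Prod>j<m. ipoly Q (unity n ^ Suc j)) \<in> \<int>"
proof -
  have n0: "n > 0" using n by simp
  obtain u where u: "\<And>z. z ^ n = 1 \<Longrightarrow> ipoly Q z = fourier n (\<lambda>k. of_int (u (k mod int n))) z"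
    using ipoly_fourier[OF n0] by blast
  let ?\<phi> = "\<lambda>k. complex_of_int (u (k mod int n))"
  \<comment> \<open>For an odd function the value at -k is minus the value at k, so the columns k
    and -k of the circulant combine to u(i - k) - u(i + k).\<close>
  define C where "C = mat m m (\<lambda>(i, k). u ((int (Suc i) - int (Suc k)) mod int n)
                                 - u ((int (Suc i) + int (Suc k)) mod int n))"
  let ?C = "map_mat complex_of_int C"
  let ?q = "\<lambda>j. ipoly Q (unity n ^ Suc j)"
  let ?D = "mat m m (\<lambda>(i, j). if i = j then ?q j else 0)"
  have cC: "?C \<in> carrier_mat m m" by (simp add: C_def)
  have cD: "?D \<in> carrier_mat m m" by simp
  have "?C * sine_mat = sine_mat * ?D"
  proof (rule eq_matI)
    fix i j assume "i < dim_row (sine_mat * ?D)" "j < dim_col (sine_mat * ?D)"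
    then have ij: "i < m" "j < m" by (auto simp: sine_mat_def)
    let ?I = "int (Suc i)" and ?J = "int (Suc j)" 
    define z where "z = unity n ^ Suc j"
    have zn: "z ^ n = 1" unfolding z_def
      by (metis unity_power[OF n0] mult.commute power_mult power_one)
    have wz: "unity n powi (a * ?J) = z powi a" for a
      unfolding z_def by (simp only: power_int_mult[symmetric] power_int_of_nat[symmetric] mult.commute)
    have wz': "unity n powi (- (a * ?J)) = z powi (- a)" for a
      using wz[of "- a"] by (simp only: mult_minus_left)
    have qz: "?q j = ipoly Q z" by (simp only: z_def)
    define \<chi> where "\<chi> k = (?\<phi> (?I - k) - ?\<phi> (?I + k)) * (z powi k - z powi (- k))" for k
    have "(?C * sine_mat) $$ (i, j) = (\<Sum>k<m. ?C $$ (i, k) * sine_mat $$ (k, j))"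
      by (rule index_mult_mat_sum[OF cC sine_mat_carrier ij])
    also have "\<dots> = (\<Sum>k<m. \<chi> (int (Suc k)))"
      by (rule sum.cong) (use ij in \<open>simp_all add: C_def sine_mat_def \<chi>_def wz wz' del: of_nat_Suc power_Suc\<close>)
    finally have S: "(?C * sine_mat) $$ (i, j) = (\<Sum>k<m. \<chi> (int (Suc k)))" .
    have "(\<Sum>k<n. \<chi> (int k)) = \<chi> 0 + 2 * (\<Sum>k<m. \<chi> (int (Suc k)))"
      unfolding n
    proof (rule sum_even_fold, unfold n[symmetric])
      fix k
      have "z powi (k mod int n) = z powi k" "z powi (- (k mod int n)) = z powi (- k)"
        using powi_mod_root[OF zn n0, of k] by (simp_all add: power_int_minus)
      moreover have "(?I - k mod int n) mod int n = (?I - k) mod int n" 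
        "(?I + k mod int n) mod int n = (?I + k) mod int n"
        by (simp_all only: mod_simps)
      ultimately show "\<chi> (k mod int n) = \<chi> k" unfolding \<chi>_def by metis
      show "\<chi> (- k) = \<chi> k" by (simp add: \<chi>_def algebra_simps del: of_nat_Suc)
    qed
    then have 2: "2 * (?C * sine_mat) $$ (i, j) = (\<Sum>k<n. \<chi> (int k))"
      by (simp add: S \<chi>_def)
    define g where "g x = (\<Sum>k<n. ?\<phi> (int k) * x ^ k)" for x
    have tw: "(\<Sum>c<n. ?\<phi> (?I + e * int c) * z powi (d * int c))
       = z powi (- d * e * ?I) * g (z powi (d * e))"
      if "e = 1 \<or> e = -1" "d = 1 \<or> d = -1" for e d
      unfolding g_def by (rule sum_twisted) (use n0 zn that in auto)
    have q: "g z = ?q j" "g (inverse z) = ?q j"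
      unfolding qz g_def using u[of z] u[of "inverse z"] sym[OF zn] zn by (simp_all add: fourier_def power_inverse)
    have "(\<Sum>k<n. \<chi> (int k)) =
       (\<Sum>c<n. ?\<phi> (?I + -1 * int c) * z powi (1 * int c)) - (\<Sum>c<n. ?\<phi> (?I + -1 * int c) * z powi (-1 * int c))
       - ((\<Sum>c<n. ?\<phi> (?I + 1 * int c) * z powi (1 * int c)) - (\<Sum>c<n. ?\<phi> (?I + 1 * int c) * z powi (-1 * int c)))"
      unfolding sum_subtractf[symmetric] \<chi>_def by (intro sum.cong refl) (simp add: algebra_simps)
    \<comment> \<open>The four sums yield z^I or z^(-I) times \<open>g z\<close> or
      \<open>g (inverse z)\<close>; by the symmetry of Q both values of \<open>g\<close> are Q(z),
      so equal terms pair up.\<close>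
    also have "\<dots> = 2 * ((z powi ?I - z powi (- ?I)) * ?q j)"
      by (subst (1 2 3 4) tw) (simp_all add: q algebra_simps del: of_nat_Suc power_Suc)
    finally have L: "(?C * sine_mat) $$ (i, j) = (z powi ?I - z powi (- ?I)) * ?q j"
      using 2 by simp
    have "(sine_mat * ?D) $$ (i, j) = (\<Sum>c<m. sine_mat $$ (i, c) * ?D $$ (c, j))"
      by (rule index_mult_mat_sum[OF sine_mat_carrier cD]) (use ij in auto)
    also have "\<dots> = (\<Sum>c<m. if c = j then sine_mat $$ (i, j) * ?q j else 0)"
      by (rule sum.cong) (use ij in auto)
    also have "\<dots> = sine_mat $$ (i, j) * ?q j"
      using ij by (subst sum.delta) auto
    also have "sine_mat $$ (i, j) = z powi ?I - z powi (- ?I)"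
      using ij by (simp add: sine_mat_def wz wz' del: of_nat_Suc power_Suc)
    finally show "(?C * sine_mat) $$ (i, j) = (sine_mat * ?D) $$ (i, j)" using L by simp
  qed (auto simp: C_def sine_mat_def)
  then have "det ?C * det sine_mat = det sine_mat * det ?D"
    by (simp only: det_mult[OF cC sine_mat_carrier, symmetric] det_mult[OF sine_mat_carrier cD, symmetric])
  then have "det ?C * det sine_mat = det ?D * det sine_mat"
    by (simp only: mult.commute)
  then have "det ?C = det ?D" by (rule mult_right_cancel[OF det_sine_mat, THEN iffD1])
  also have "det ?D = (\<Prod>j<m. ?q j)" by (rule det_diagonal_entries)
  finally show ?thesis by (metis of_int_hom.hom_det Ints_of_int)
qed

end

section \<open>Odd prime divisors\<close>

text \<open>The Frobenius congruence Q(x)^p = Q(x^p) mod p, by induction on the coefficients: the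
  inner binomial coefficients are divisible by p, and Fermat handles the constant term.\<close>

lemma int_poly_power_prime:
  fixes Q :: "int poly"
  assumes p: "prime p"
  shows "[:int p:] dvd Q ^ p - pcompose Q (monom 1 p)"
proof -
  have p0: "p > 0" using p by (rule prime_gt_0_nat)
  have binom: "[:int p:] dvd (A + B) ^ p - (A ^ p + B ^ p)" for A B :: "int poly"
  proof -
    have "(A + B) ^ p = (\<Sum>k\<in>{..p}. of_nat (p choose k) * A ^ k * B ^ (p - k))"
      by (rule binomial_ring)
    also have "{..p} = insert 0 (insert p {0<..<p})" using p0 by auto
    also have "(\<Sum>k\<in>\<dots>. of_nat (p choose k) * A ^ k * B ^ (p - k))
        = A ^ p + B ^ p + (\<Sum>k\<in>{0<..<p}. of_nat (p choose k) * A ^ k * B ^ (p - k))"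
      using p0 by (simp add: algebra_simps)
    finally have *: "(A + B) ^ p - (A ^ p + B ^ p) = (\<Sum>k\<in>{0<..<p}. of_nat (p choose k) * A ^ k * B ^ (p - k))"
      by simp
    have "[:int p:] dvd of_nat (p choose k)" if "k \<in> {0<..<p}" for k
    proof -
      have "p dvd (p choose k)" using that p by (intro dvd_choose_prime) auto
      then have "int p dvd int (p choose k)" by simp
      then show ?thesis by (simp add: of_nat_poly const_poly_dvd_iff coeff_pCons split: nat.split)
    qed
    then show ?thesis unfolding * by (intro dvd_sum dvd_mult2)
  qed
  show ?thesis
  proof (induction Q rule: pCons_induct)
    case 0
    then show ?case using p0 by (simp add: zero_power)
  next
    case (pCons a Q)
    have "int p dvd a ^ p - a"
    proof -
      have "[a ^ p = a] (mod int p)"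
      proof (cases "int p dvd a")
        case True
        then have "int p dvd a ^ p" using p0 by (meson dvd_power dvd_trans)
        then show ?thesis using True by (simp add: cong_def)
      next
        case False
        have pr: "prime (int p)" using p by simp
        \<comment> \<open>A natural number representative of a mod p, to which
          \<open>fermat_theorem\<close> is applied.\<close>
        define b where "b = nat (a mod int p)"
        have b: "int b = a mod int p" using p0 by (simp add: b_def)
        have "\<not> p dvd b" using False b by (metis dvd_mod_iff dvd_refl int_dvd_int_iff)
        then have "[b ^ (p - 1) = 1] (mod p)" using p by (intro fermat_theorem)
        then have "[b ^ (p - 1) * b = 1 * b] (mod p)" by (rule cong_scalar_right)
        then have "[b ^ p = b] (mod p)" using p0 by (metis mult_1 power_minus_mult)
        then have "[int b ^ p = int b] (mod int p)" by (metis cong_int_iff of_nat_power)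
        moreover have "[int b = a] (mod int p)" by (simp add: b cong_def)
        ultimately show ?thesis by (meson cong_pow cong_sym cong_trans)
      qed
      then show ?thesis by (simp add: cong_iff_dvd_diff)
    qed
    then have 1: "[:int p:] dvd [:a:] ^ p - [:a:]"
      by (simp add: poly_const_pow const_poly_dvd_iff coeff_pCons split: nat.split)
    have e: "pCons a Q = [:a:] + monom 1 1 * Q" by (simp add: monom_altdef)
    have "pCons a Q ^ p - pcompose (pCons a Q) (monom 1 p)
       = (([:a:] + monom 1 1 * Q) ^ p - ([:a:] ^ p + (monom 1 1 * Q) ^ p)) + ([:a:] ^ p - [:a:])
         + monom 1 p * (Q ^ p - pcompose Q (monom 1 p))"
      unfolding e[symmetric] by (simp add: pcompose_pCons power_mult_distrib monom_power algebra_simps)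
    then show ?case
      using binom[of "[:a:]" "monom 1 1 * Q"] 1 dvd_mult[OF pCons.IH, of "monom 1 p"] by (metis dvd_add)
  qed
qed

lemma int_poly_power_prime_power:
  fixes Q :: "int poly"
  assumes p: "prime p"
  shows "[:int p:] dvd Q ^ (p ^ a) - pcompose Q (monom 1 (p ^ a))"
proof (induction a)
  case 0
  have "monom 1 1 = [:0, 1 :: int:]" by (simp add: monom_altdef)
  then show ?case by (simp add: pcompose_idR)
next
  case (Suc a)
  let ?q = "p ^ a" and ?R = "pcompose Q (monom 1 (p ^ a))"
  have "Q ^ ?q - ?R dvd (Q ^ ?q) ^ p - ?R ^ p" 
    by (metis power_diff_sumr2 dvd_triv_left)
  then have 1: "[:int p:] dvd (Q ^ ?q) ^ p - ?R ^ p" using Suc.IH dvd_trans by blast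
  have 2: "[:int p:] dvd ?R ^ p - pcompose ?R (monom 1 p)" by (rule int_poly_power_prime[OF p])
  have "pcompose ?R (monom 1 p) = pcompose Q (pcompose (monom 1 ?q) (monom 1 p))"
    by (rule pcompose_assoc[symmetric])
  also have "pcompose (monom 1 ?q) (monom 1 p) = (monom 1 (p * ?q) :: int poly)"
    by (induction ("?q")) (auto simp: pcompose_pCons monom_Suc mult_monom pcompose_1 add.commute)
  finally have 3: "pcompose ?R (monom 1 p) = pcompose Q (monom 1 (p ^ Suc a))" by simp
  have "Q ^ (p ^ Suc a) = (Q ^ ?q) ^ p" by (simp add: power_mult[symmetric] mult.commute)
  then show ?case using dvd_add[OF 1 2] 3 by simp
qed

section \<open>Products over all n-th roots of unity\<close>

lemma bij_betw_power_roots_unity: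
  assumes n: "n > 0" and k: "coprime k n"
  shows "bij_betw (\<lambda>z :: complex. z ^ k) {z. z ^ n = 1} {z. z ^ n = 1}"
proof -
  have fin: "finite {z :: complex. z ^ n = 1}" using bij_betw_finite[OF bij_betw_unity[OF n]] by simp
  have inj: "inj_on (\<lambda>z :: complex. z ^ k) {z. z ^ n = 1}"
  proof (rule inj_onI, simp)
    fix z w :: complex assume zw: "z ^ n = 1" "w ^ n = 1" "z ^ k = w ^ k"
    have w0: "w \<noteq> 0" using zw(2) n by (auto simp: power_0_left)
    define t where "t = z / w"
    have t: "t ^ n = 1" "t ^ k = 1" using zw w0 by (auto simp: t_def power_divide)
    then have t0: "t \<noteq> 0" using n by (auto simp: power_0_left)
    \<comment> \<open>Bezout: t^k = t^n = 1 with k and n coprime forces t = 1. Injectivity on a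
      finite set then gives the bijection.\<close>
    obtain a b where ab: "a * int k + b * int n = 1"
      using k bezout_int[of "int k" "int n"] by (metis coprime_iff_gcd_eq_1 coprime_int_iff)
    have "t = t powi (a * int k + b * int n)" by (simp add: ab)
    also have "\<dots> = (t powi int k) powi a * (t powi int n) powi b"
      using t0 by (simp only: power_int_add power_int_mult mult.commute[of a] mult.commute[of b] simp_thms)
    also have "\<dots> = 1" using t by simp
    finally show "z = w" using w0 by (simp add: t_def)
  qed
  have "(\<lambda>z :: complex. z ^ k) ` {z. z ^ n = 1} \<subseteq> {z. z ^ n = 1}"
    by auto (metis mult.commute power_mult power_one)
  then have "(\<lambda>z :: complex. z ^ k) ` {z. z ^ n = 1} = {z. z ^ n = 1}"
    using endo_inj_surj[OF fin _ inj] by blast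
  then show ?thesis using inj by (simp add: bij_betw_def)
qed

text \<open>The resultant of x^n - 1 and Q, written E_n(Q) in the opening comment.\<close>

definition root_prod :: "nat \<Rightarrow> int poly \<Rightarrow> complex" where
  "root_prod n Q = (\<Prod>z | z ^ n = 1. ipoly Q z)"

lemma root_prod_unity: "n > 0 \<Longrightarrow> root_prod n Q = (\<Prod>j<n. ipoly Q (unity n ^ j))"
  unfolding root_prod_def by (rule prod.reindex_bij_betw[OF bij_betw_unity, symmetric])

text \<open>The roots w^j and w^(n-j) are inverse to each other and contribute equal factors; only
  the root 1 remains unpaired.\<close>

lemma root_prod_half:
  assumes n: "n = 2 * m + 1" and sym: "\<And>z. z ^ n = 1 \<Longrightarrow> ipoly Q (inverse z) = ipoly Q z"
  shows "root_prod n Q = of_int (poly Q 1) * (\<Prod>j<m. ipoly Q (unity n ^ Suc j))\<^sup>2"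
proof -
  let ?f = "\<lambda>j. ipoly Q (unity n ^ j)"
  have n0: "n > 0" using n by simp
  have "root_prod n Q = (\<Prod>j<Suc (m + m). ?f j)"
    using root_prod_unity[OF n0] n by (simp add: mult_2)
  also have "\<dots> = ?f 0 * (\<Prod>j<m + m. ?f (Suc j))"
    by (simp only: prod.lessThan_Suc_shift)
  also have "(\<Prod>j<m + m. ?f (Suc j)) = (\<Prod>j<m. ?f (Suc j)) * (\<Prod>j<m. ?f (Suc (m + j)))"
  proof -
    have "(\<Prod>j<m + r. ?f (Suc j)) = (\<Prod>j<m. ?f (Suc j)) * (\<Prod>j<r. ?f (Suc (m + j)))" for r
      by (induction r) (simp_all add: mult.assoc)
    then show ?thesis .
  qed
  also have "(\<Prod>j<m. ?f (Suc (m + j))) = (\<Prod>j<m. ?f (Suc (m + (m - Suc j))))"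
    by (rule prod.nat_diff_reindex[symmetric])
  also have "\<dots> = (\<Prod>j<m. ?f (Suc j))"
  proof (rule prod.cong[OF refl])
    fix j assume "j \<in> {..<m}"
    then have "Suc (m + (m - Suc j)) + Suc j = n" using n by simp
    then have "unity n ^ Suc (m + (m - Suc j)) * unity n ^ Suc j = 1"
      using unity_power[OF n0] by (simp only: power_add[symmetric])
    then have "unity n ^ Suc (m + (m - Suc j)) = inverse (unity n ^ Suc j)"
      by (metis inverse_unique mult.commute)
    moreover have "(unity n ^ Suc j) ^ n = 1"
      by (metis unity_power[OF n0] mult.commute power_mult power_one)
    ultimately show "?f (Suc (m + (m - Suc j))) = ?f (Suc j)" using sym by metis
  qed
  finally show ?thesis by (simp add: power2_eq_square ipoly_1)
qed

lemma root_prod_prime_cube_dvd: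
  assumes p: "prime p" "odd p" and n: "odd n" "p dvd n"
    and sym: "\<And>z. z ^ n = 1 \<Longrightarrow> ipoly Q (inverse z) = ipoly Q z"
    and e: "root_prod n Q = of_int e" "e \<noteq> 0" "int p dvd e"
  shows "int p ^ 3 dvd e"
proof -
  have n0: "n > 0" using n by (auto elim: oddE)
  have p1: "p > 1" using p(1) by (rule prime_gt_1_nat)
  obtain m where m: "n = p ^ multiplicity p n * m" "\<not> p dvd m"
    using multiplicity_decompose'[of n p] n0 p1 by auto
  define q where "q = p ^ multiplicity p n"
  have nqm: "n = q * m" using m by (simp add: q_def)
  have m0: "m > 0" "odd m" and q0: "q > 0" "odd q" using nqm n n0 by (auto elim: oddE)
  have "multiplicity p n > 0" using n n0 p(1) p1 by (simp add: prime_multiplicity_gt_zero_iff)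
  then have "p dvd q" by (simp add: q_def)
  then have q3: "q \<ge> 3" using p1 q0 dvd_imp_le[of p q] p(2) by (cases "p = 2") auto
  have cop: "coprime q m"
    using m(2) p(1) by (simp add: q_def prime_imp_coprime)
  obtain m' where m': "m = 2 * m' + 1" using m0 by (auto elim: oddE)
  obtain n' where n': "n = 2 * n' + 1" using n by (auto elim: oddE)
  have symm: "ipoly Q (inverse z) = ipoly Q z" if "z ^ m = 1" for z
    using sym[of z] that by (simp add: nqm mult.commute[of q] power_mult)
  have um: "unity m = unity n ^ q" using m0 q0 by (simp add: unity_def DeMoivre nqm field_simps)
  let ?f = "\<lambda>j. ipoly Q (unity n ^ j)"
  \<comment> \<open>w^j is an m-th root of unity iff q divides j. \<open>K\<close> indexes all the
    other n-th roots, \<open>J\<close> one of each inverse pair of them, with exponent j +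
    1.\<close>
  define J where "J = {j. j < n' \<and> \<not> q dvd Suc j}"
  define K where "K = {j. j < n \<and> \<not> q dvd j}"
  define A where "A = (\<Prod>j<m'. ipoly Q (unity m ^ Suc j))"
  define B where "B = (\<Prod>j\<in>J. ?f (Suc j))"
  have AB: "(\<Prod>j<n'. ?f (Suc j)) = A * B"
  proof -
    have "(\<Prod>j<n'. ?f (Suc j)) = (\<Prod>j\<in>{j. j < n' \<and> q dvd Suc j} \<union> J. ?f (Suc j))"
      by (rule prod.cong) (auto simp: J_def)
    also have "\<dots> = (\<Prod>j\<in>{j. j < n' \<and> q dvd Suc j}. ?f (Suc j)) * B"
      unfolding B_def by (rule prod.union_disjoint) (auto simp: J_def)
    also have "(\<Prod>j\<in>{j. j < n' \<and> q dvd Suc j}. ?f (Suc j)) = A"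
      unfolding A_def
    proof (rule prod.reindex_bij_witness[of _ "\<lambda>i. q * Suc i - 1" "\<lambda>j. Suc j div q - 1"])
      fix j assume "j \<in> {j. j < n' \<and> q dvd Suc j}"
      then obtain c where c: "Suc j = q * c" and j: "j < n'" by (auto elim: dvdE)
      have c0: "c > 0" using c by (cases c) auto
      have "2 * (q * c) < q * m" using c j n' nqm by linarith
      then have "2 * c < m" by (metis mult.left_commute mult_less_cancel1)
      then show "Suc j div q - 1 \<in> {..<m'}" using c c0 q0 m' by auto
      show "q * Suc (Suc j div q - 1) - 1 = j" using c c0 q0 by simp
      show "ipoly Q (unity m ^ Suc (Suc j div q - 1)) = ?f (Suc j)"
        using c c0 q0 by (simp add: um power_mult[symmetric] del: power_Suc)
    next
      fix i assume i: "i \<in> {..<m'}"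
      have pos: "Suc (q * Suc i - 1) = q * Suc i" using q0 by simp
      show "Suc (q * Suc i - 1) div q - 1 = i" unfolding pos using q0 by simp
      have "2 * Suc i < m" using i m' by auto
      then have "q * (2 * Suc i) < q * m" using q0 by (simp only: mult_less_cancel1)
      then have "q * Suc i - 1 < n'" using n' nqm q0 by auto
      then show "q * Suc i - 1 \<in> {j. j < n' \<and> q dvd Suc j}" using pos by auto
    qed
    finally show ?thesis .
  qed
  obtain a where a: "A = of_int a"
    using half_prod_Ints[OF m', of Q, OF symm] by (auto simp: A_def elim: Ints_cases)
  obtain c where c: "A * B = of_int c"
    using half_prod_Ints[OF n', of Q, OF sym] unfolding AB by (auto elim: Ints_cases)
  define em where "em = poly Q 1 * a\<^sup>2"
  have Em: "root_prod m Q = of_int em"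
    using root_prod_half[OF m' symm] a by (simp add: A_def em_def)
  have En: "root_prod n Q = of_int em * B\<^sup>2"
    using root_prod_half[OF n' sym] a unfolding AB by (simp add: em_def power_mult_distrib)
  have nz: "em \<noteq> 0" "A \<noteq> 0" using En e a by (auto simp: em_def)
  \<comment> \<open>A and AB are half products for m and n, hence integers. So B is rational, and as
    a polynomial value at \<open>unity n\<close> it is an integer.\<close>
  have "B = of_int c / of_int a" using c nz a by (simp add: field_simps)
  then have "B \<in> \<rat>" by simp
  moreover have "B = ipoly (\<Prod>j\<in>J. pcompose Q (monom 1 (Suc j))) (unity n)"
    by (simp add: B_def ipoly_prod)
  ultimately obtain b where b: "B = of_int b"
    using cyclotomic_integer_rational[OF n0] by (metis Ints_cases)
  have e': "e = em * b\<^sup>2" using En e(1) b by (metis of_int_eq_iff of_int_mult of_int_power)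
  have split: "(\<Prod>j<n. g j) = (\<Prod>i<m. g (q * i)) * (\<Prod>j\<in>K. g j)" for g :: "nat \<Rightarrow> complex"
  proof -
    have "(\<Prod>j<n. g j) = (\<Prod>j\<in>{j. j < n \<and> q dvd j} \<union> K. g j)"
      by (rule prod.cong) (auto simp: K_def)
    also have "\<dots> = (\<Prod>j\<in>{j. j < n \<and> q dvd j}. g j) * (\<Prod>j\<in>K. g j)"
      by (rule prod.union_disjoint) (auto simp: K_def)
    also have "(\<Prod>j\<in>{j. j < n \<and> q dvd j}. g j) = (\<Prod>i<m. g (q * i))"
      by (rule prod.reindex_bij_witness[of _ "\<lambda>i. q * i" "\<lambda>j. j div q"])
         (use q0 in \<open>auto simp: nqm\<close>)
    finally show ?thesis .
  qed
  \<comment> \<open>Applying Frobenius to a single polynomial P with P(w) = B^2 and P(w^q) = E_m^(q-1),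
    w = unity n, avoids congruences between algebraic integers.\<close>
  define P where "P = (\<Prod>j\<in>K. pcompose Q (monom 1 j))"
  have P: "ipoly P z = (\<Prod>j\<in>K. ipoly Q (z ^ j))" for z
    by (simp add: P_def ipoly_prod)
  have "of_int e = of_int em * ipoly P (unity n)"
    using split[of ?f] Em root_prod_unity[OF n0, of Q] root_prod_unity[OF m0(1), of Q] e(1)
    by (simp add: P um power_mult[symmetric])
  then have PB: "ipoly P (unity n) = of_int (b\<^sup>2)" using nz by (simp add: e')
  \<comment> \<open>Here w^q = \<open>unity m\<close>. As j runs below n = qm, its powers run q
    times through the m-th roots, giving E_m^q. The multiples of q account for one factor E_m,
    because raising to the power q permutes the m-th roots; the indices in \<open>K\<close> account
    for the rest.\<close>
  have Pq: "ipoly P (unity n ^ q) = of_int (em ^ (q - 1))"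
  proof -
    let ?g = "\<lambda>j. ipoly Q (unity m ^ j)"
    have per: "?g (j + q' * m) = ?g j" for j q'
      using unity_power[OF m0(1)] by (simp add: power_add power_mult mult.commute[of q'])
    have "(\<Prod>j<n. ?g j) = (\<Prod>i<q. \<Prod>j\<in>{i * m..<i * m + m}. ?g j)"
      by (simp only: nqm prod.nat_group)
    also have "\<dots> = (\<Prod>i<q. root_prod m Q)"
    proof (rule prod.cong[OF refl])
      fix i
      have "(\<Prod>j\<in>{i * m..<i * m + m}. ?g j) = (\<Prod>j\<in>{0 + i * m..<m + i * m}. ?g j)"
        by (simp add: add.commute)
      also have "\<dots> = (\<Prod>j\<in>{0..<m}. ?g (j + i * m))" by (rule prod.shift_bounds_nat_ivl)
      finally show "(\<Prod>j\<in>{i * m..<i * m + m}. ?g j) = root_prod m Q"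
        using root_prod_unity[OF m0(1)] by (simp add: per atLeast0LessThan)
    qed
    finally have 1: "(\<Prod>j<n. ?g j) = of_int em ^ q" by (simp add: Em)
    have "(\<Prod>i<m. ?g (q * i)) = (\<Prod>z | z ^ m = 1. ipoly Q (z ^ q))"
      using prod.reindex_bij_betw[OF bij_betw_unity[OF m0(1)], of "\<lambda>z. ipoly Q (z ^ q)"]
      by (simp add: power_mult[symmetric] mult.commute)
    also have "\<dots> = root_prod m Q"
      unfolding root_prod_def
      by (rule prod.reindex_bij_betw[OF bij_betw_power_roots_unity[OF m0(1) cop]])
    finally have "of_int em * (\<Prod>j\<in>K. ?g j) = of_int em ^ q"
      using 1 split[of ?g] by (simp add: Em)
    moreover have "(of_int em :: complex) ^ q = of_int em * of_int em ^ (q - 1)"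
      using q0 by (metis Suc_pred' power_Suc)
    ultimately show ?thesis using nz by (simp add: P um)
  qed
  obtain S where "P ^ q - pcompose P (monom 1 q) = [:int p:] * S"
    using int_poly_power_prime_power[OF p(1), of P "multiplicity p n"] by (auto simp: q_def)
  then have "ipoly (P ^ q - pcompose P (monom 1 q)) (unity n) = ipoly ([:int p:] * S) (unity n)"
    by (rule arg_cong)
  then have S: "of_int ((b\<^sup>2) ^ q - em ^ (q - 1)) = of_int (int p) * ipoly S (unity n)"
    by (simp add: PB Pq)
  then have "ipoly S (unity n) = of_int ((b\<^sup>2) ^ q - em ^ (q - 1)) / of_int (int p)"
    using p1 by (simp add: field_simps)
  then have "ipoly S (unity n) \<in> \<rat>" by simp
  then obtain s where "ipoly S (unity n) = of_int s"
    using cyclotomic_integer_rational[OF n0] by (metis Ints_cases)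
  with S have "(b\<^sup>2) ^ q - em ^ (q - 1) = int p * s"
    by (metis of_int_eq_iff of_int_mult)
  then have d: "int p dvd (b\<^sup>2) ^ q - em ^ (q - 1)" by simp
  have pp: "prime (int p)" using p by simp
  have "int p dvd em \<or> int p dvd b" 
    using e(3) pp unfolding e' by (meson prime_dvd_mult_iff prime_dvd_power)
  \<comment> \<open>The congruence b^(2q) = em^(q-1) mod p has positive exponents on both sides, as
    q >= 3.\<close>
  moreover have "int p dvd em \<longleftrightarrow> int p dvd b"
  proof -
    have "int p dvd em \<longleftrightarrow> int p dvd em ^ (q - 1)"
      using pp q3 by (simp add: prime_dvd_power_iff)
    also have "\<dots> \<longleftrightarrow> int p dvd (b\<^sup>2) ^ q"
      using d by (metis dvd_diff_commute dvd_add_right_iff diff_add_cancel)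
    also have "\<dots> \<longleftrightarrow> int p dvd b"
      using pp q3 by (simp add: power_mult[symmetric] prime_dvd_power_iff)
    finally show ?thesis .
  qed
  ultimately have "int p dvd em" "int p dvd b" by auto
  then have "int p * (int p)\<^sup>2 dvd em * b\<^sup>2" by (intro mult_dvd_mono dvd_power_same)
  then show ?thesis by (simp add: e' power3_eq_cube power2_eq_square mult.assoc)
qed

section \<open>Divisibility of the dicyclic determinants\<close>

lemma power_n_minus_1_root:
  fixes s :: complex
  assumes "s ^ n = 1" "n > 0"
  shows "s ^ (n - 1) = inverse s"
proof -
  have "s * s ^ (n - 1) = 1" using assms by (metis power_eq_if not_gr_zero)
  then show ?thesis by (rule inverse_unique[symmetric])
qed

text \<open>On the n-th roots of unity, substituting x^(n-1) for x is inversion.\<close>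

definition norm_form :: "nat \<Rightarrow> int \<Rightarrow> int poly \<Rightarrow> int poly \<Rightarrow> int poly" where
  "norm_form n c F G = F * pcompose F (monom 1 (n - 1)) - [:c:] * (G * pcompose G (monom 1 (n - 1)))"

lemma ipoly_norm_form:
  assumes "s ^ n = 1" "n > 0"
  shows "ipoly (norm_form n c F G) s
       = ipoly F s * ipoly F (inverse s) - of_int c * (ipoly G s * ipoly G (inverse s))"
  using power_n_minus_1_root[OF assms] by (simp add: norm_form_def)

lemma norm_form_inverse:
  assumes "s ^ n = 1" "n > 0"
  shows "ipoly (norm_form n c F G) (inverse s) = ipoly (norm_form n c F G) s"
  using ipoly_norm_form[of s n c F G] ipoly_norm_form[of "inverse s" n c F G] assms
  by (simp add: power_inverse mult.commute)

lemma poly_norm_form_1: "poly (norm_form n c F G) 1 = (poly F 1)\<^sup>2 - c * (poly G 1)\<^sup>2"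
  by (simp add: norm_form_def poly_pcompose poly_monom power2_eq_square)

section \<open>Splitting the determinant over s and -s\<close>

lemma prod_roots_double:
  fixes h :: "complex \<Rightarrow> complex"
  assumes n: "odd n"
  shows "(\<Prod>z | z ^ (2 * n) = 1. h z) = (\<Prod>s | s ^ n = 1. h s * h (- s))"
proof -
  let ?R = "{s :: complex. s ^ n = 1}"
  have n0: "n > 0" using n by (rule odd_pos)
  have fin: "finite ?R" using bij_betw_finite[OF bij_betw_unity[OF n0]] by simp
  have "{z :: complex. z ^ (2 * n) = 1} = ?R \<union> uminus ` ?R"
  proof (intro equalityI subsetI)
    fix z :: complex assume "z \<in> {z. z ^ (2 * n) = 1}"
    then have "(z ^ n)\<^sup>2 = 1" by (simp add: power_mult[symmetric] mult.commute)
    then have "z ^ n = 1 \<or> (- z) ^ n = 1" using n by (auto simp: power2_eq_1_iff)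
    then show "z \<in> ?R \<union> uminus ` ?R" by (auto intro: image_eqI[of _ _ "- z"])
  next
    fix z :: complex assume "z \<in> ?R \<union> uminus ` ?R"
    then show "z \<in> {z. z ^ (2 * n) = 1}" using n by (auto simp: power_mult mult.commute[of 2])
  qed
  moreover have "?R \<inter> uminus ` ?R = {}" using n by auto
  ultimately have "(\<Prod>z | z ^ (2 * n) = 1. h z) = (\<Prod>s\<in>?R. h s) * (\<Prod>s\<in>uminus ` ?R. h s)"
    using fin by (simp add: prod.union_disjoint)
  also have "(\<Prod>s\<in>uminus ` ?R. h s) = (\<Prod>s\<in>?R. h (- s))"
    by (subst prod.reindex) auto
  finally show ?thesis by (simp add: prod.distrib)
qed

abbreviation reflect :: "int poly \<Rightarrow> int poly" where
  "reflect F \<equiv> pcompose F [:0, - 1:]"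

text \<open>As n is odd, z^n is 1 at z = s and -1 at z = -s. This gives the constants of the two
  norm forms, and \<open>reflect\<close> moves the evaluation from -s to s.\<close>

lemma dicyclic_product_split:
  assumes n: "odd n"
  shows "(\<Prod>z | z ^ (2 * n) = 1. ipoly F z * ipoly F (inverse z) - z ^ n * (ipoly G z * ipoly G (inverse z)))
       = root_prod n (norm_form n 1 F G) * root_prod n (norm_form n (- 1) (reflect F) (reflect G))"
proof -
  have n0: "n > 0" using n by (rule odd_pos)
  show ?thesis
    unfolding prod_roots_double[OF n] root_prod_def prod.distrib[symmetric]
    by (rule prod.cong[OF refl]) (use n n0 in \<open>simp add: ipoly_norm_form\<close>)
qed

section \<open>Parity and divisibility by 16\<close>

lemma dvd_prod_diff:
  fixes f g :: "'b \<Rightarrow> 'a :: comm_ring_1"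
  assumes "\<And>i. i \<in> I \<Longrightarrow> d dvd f i - g i"
  shows "d dvd prod f I - prod g I"
  using assms
proof (induction I rule: infinite_finite_induct)
  case (insert x I)
  have "prod f (insert x I) - prod g (insert x I) = (f x - g x) * prod f I + g x * (prod f I - prod g I)"
    using insert by (simp add: algebra_simps)
  then show ?case using insert by simp
qed auto

lemma reflect_mod_2: "[:2:] dvd reflect F - F"
proof (induction F rule: pCons_induct)
  case (pCons a F)
  then obtain K where K: "reflect F = F + [:2:] * K" by (metis dvdE diff_eq_eq add.commute)
  define X where "X = [:0, 1 :: int:]"
  have X: "[:0, - 1:] = - X" by (simp add: X_def)
  have "reflect (pCons a F) - pCons a F = ([:a:] + [:0, - 1:] * reflect F) - ([:a:] + X * F)"
    by (simp add: pcompose_pCons X_def)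
  also have "\<dots> = [:2:] * (- (X * F) - X * K)"
    unfolding K unfolding X numeral_poly[symmetric] by (simp add: algebra_simps)
  finally have "reflect (pCons a F) - pCons a F = [:2:] * (- (X * F) - X * K)" .
  then show ?case by (rule dvdI)
qed simp

lemma norm_form_mod_2: "[:2:] dvd norm_form n (- 1) (reflect F) (reflect G) - norm_form n 1 F G"
proof -
  obtain K where K: "reflect F = F + [:2:] * K" using reflect_mod_2 by (metis dvdE diff_eq_eq add.commute)
  obtain L where L: "reflect G = G + [:2:] * L" using reflect_mod_2 by (metis dvdE diff_eq_eq add.commute)
  let ?c = "\<lambda>P :: int poly. pcompose P (monom 1 (n - 1))"
  have two: "[:2 :: int:] = 2" by (simp add: numeral_poly)
  have c2: "?c 2 = 2" unfolding two[symmetric] by simp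
  have "norm_form n (- 1) (reflect F) (reflect G) - norm_form n 1 F G
    = [:2:] * (F * ?c K + K * ?c F + [:2:] * K * ?c K + G * ?c L + L * ?c G + [:2:] * L * ?c L + G * ?c G)"
    unfolding norm_form_def K L pcompose_add pcompose_mult c2 two
    by (simp add: algebra_simps one_pCons[symmetric])
  then show ?thesis by (rule dvdI)
qed

lemma root_prod_Ints:
  assumes n: "n = 2 * m + 1" and sym: "\<And>z. z ^ n = 1 \<Longrightarrow> ipoly Q (inverse z) = ipoly Q z"
  obtains a where "(\<Prod>j<m. ipoly Q (unity n ^ Suc j)) = of_int a" "root_prod n Q = of_int (poly Q 1 * a\<^sup>2)"
proof -
  obtain a where a: "(\<Prod>j<m. ipoly Q (unity n ^ Suc j)) = of_int a"
    using half_prod_Ints[OF n, of Q, OF sym] by (metis Ints_cases)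
  have "root_prod n Q = of_int (poly Q 1 * a\<^sup>2)"
    using root_prod_half[OF n, of Q, OF sym] unfolding a by (simp only: of_int_mult of_int_power)
  with a show ?thesis by (rule that)
qed

text \<open>The congruence of P and Q in Z[x] carries over to the products of P(x^(j+1)) and
  Q(x^(j+1)). At \<open>unity n\<close> the quotient by 2 has the rational value (a - b)/2, which is
  therefore an integer.\<close>

lemma half_prod_mod_2:
  assumes n: "n > 0" and PQ: "[:2:] dvd P - Q"
    and a: "(\<Prod>j<m. ipoly P (unity n ^ Suc j)) = of_int a"
    and b: "(\<Prod>j<m. ipoly Q (unity n ^ Suc j)) = of_int b"
  shows "even (a - b)"
proof -
  let ?H = "\<lambda>P :: int poly. \<Prod>j<m. pcompose P (monom 1 (Suc j))"
  have "[:2:] dvd ?H P - ?H Q"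
  proof (rule dvd_prod_diff)
    fix j
    obtain K where "P - Q = [:2:] * K" using PQ by (elim dvdE)
    then have "pcompose P (monom 1 (Suc j)) - pcompose Q (monom 1 (Suc j)) = [:2:] * pcompose K (monom 1 (Suc j))"
      by (metis pcompose_diff pcompose_mult pcompose_const)
    then show "[:2:] dvd pcompose P (monom 1 (Suc j)) - pcompose Q (monom 1 (Suc j))" by (rule dvdI)
  qed
  then obtain S where "?H P - ?H Q = [:2:] * S" by (elim dvdE)
  then have "ipoly (?H P - ?H Q) (unity n) = ipoly ([:2:] * S) (unity n)" by (rule arg_cong)
  moreover have "ipoly (?H P) (unity n) = of_int a" "ipoly (?H Q) (unity n) = of_int b"
    using a b by (simp_all only: ipoly_prod ipoly_simps of_int_1 mult_1)
  ultimately have S: "of_int (a - b) = 2 * ipoly S (unity n)" by simp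
  then have "ipoly S (unity n) = of_int (a - b) / of_int 2" by simp
  then have "ipoly S (unity n) \<in> \<rat>" by (metis Rats_divide Rats_of_int)
  then obtain s where "ipoly S (unity n) = of_int s"
    using cyclotomic_integer_rational[OF n] by (metis Ints_cases)
  with S have "a - b = 2 * s"
    by (metis of_int_eq_iff of_int_mult of_int_numeral)
  then show ?thesis by simp
qed

text \<open>If a and b are even, the squares supply 16. Otherwise f, g, f', g' all have the same
  parity: if even, each of the two forms is divisible by 4; if odd, the difference of squares is
  divisible by 8 and the sum of squares by 2.\<close>

lemma sixteen_dvd_of_even:
  fixes a b f f' g g' :: int
  assumes ab: "even (a - b)" and f: "even (f - f')" and g: "even (g - g')"
    and D: "even D" "D = (f\<^sup>2 - g\<^sup>2) * a\<^sup>2 * ((f'\<^sup>2 + g'\<^sup>2) * b\<^sup>2)"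
  shows "16 dvd D"
proof (cases "even a")
  case True
  then have "even a" "even b" using ab by auto
  then obtain c d where "a = 2 * c" "b = 2 * d" by (auto elim!: evenE)
  then have "D = 16 * ((f\<^sup>2 - g\<^sup>2) * c\<^sup>2 * ((f'\<^sup>2 + g'\<^sup>2) * d\<^sup>2))" using D by (simp add: power2_eq_square)
  then show ?thesis by simp
next
  case False
  then have odd: "odd a" "odd b" using ab by auto
  then have "even (f - g)" using D f g by auto
  moreover have "even (f' - g')" using \<open>even (f - g)\<close> f g by auto
  ultimately obtain k l where "f - g = 2 * k" "f' - g' = 2 * l" by (elim dvdE) blast
  then have k: "f = g + 2 * k" and l: "f' = g' + 2 * l" by auto
  have 1: "f\<^sup>2 - g\<^sup>2 = 4 * (k * (k + g))" and 2: "f'\<^sup>2 + g'\<^sup>2 = 2 * (g'\<^sup>2 + 2 * (l * (l + g')))"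
    by (simp_all add: k l power2_eq_square algebra_simps)
  have "16 dvd (f\<^sup>2 - g\<^sup>2) * (f'\<^sup>2 + g'\<^sup>2)"
  proof (cases "even g")
    case True
    then have "even g'" using g by auto
    then obtain u where "g' = 2 * u" by (elim evenE)
    then have "f'\<^sup>2 + g'\<^sup>2 = 4 * (2 * u\<^sup>2 + l * (l + g'))" using 2 by (simp add: power2_eq_square)
    then have "4 dvd f'\<^sup>2 + g'\<^sup>2" by simp
    moreover have "4 dvd f\<^sup>2 - g\<^sup>2" using 1 by simp
    ultimately have "4 * 4 dvd (f\<^sup>2 - g\<^sup>2) * (f'\<^sup>2 + g'\<^sup>2)" by (intro mult_dvd_mono)
    then show ?thesis by simp
  next
    case False
    \<comment> \<open>With g odd, k and k + g have opposite parity.\<close>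
    then have "even (k * (k + g))" by auto
    then have "4 * 2 dvd 4 * (k * (k + g))" by (intro mult_dvd_mono) auto
    then have "8 dvd f\<^sup>2 - g\<^sup>2" by (simp add: 1)
    moreover have "2 dvd f'\<^sup>2 + g'\<^sup>2" by (simp add: 2)
    ultimately have "8 * 2 dvd (f\<^sup>2 - g\<^sup>2) * (f'\<^sup>2 + g'\<^sup>2)" by (intro mult_dvd_mono)
    then show ?thesis by simp
  qed
  moreover have "D = (f\<^sup>2 - g\<^sup>2) * (f'\<^sup>2 + g'\<^sup>2) * (a\<^sup>2 * b\<^sup>2)" using D by (simp add: mult_ac)
  ultimately show ?thesis by simp
qed

lemma even_poly_reflect_diff: "even (poly F 1 - poly (reflect F) (1 :: int))"
proof -
  obtain K where "reflect F - F = [:2:] * K" using reflect_mod_2[of F] by (elim dvdE)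
  then have "poly (reflect F) 1 - poly F 1 = poly ([:2:] * K) 1" by (metis poly_diff)
  also have "\<dots> = 2 * poly K 1" by simp
  finally show ?thesis by presburger
qed

lemma dicyclic_det_dvd:
  assumes n: "odd n" and D: "D \<in> int_group_dets (dicyclic n)" "D \<noteq> 0"
  shows "even D \<Longrightarrow> 16 dvd D"
    and "prime p \<Longrightarrow> odd p \<Longrightarrow> p dvd n \<Longrightarrow> int p dvd D \<Longrightarrow> int p ^ 3 dvd D"
proof -
  have n0: "n > 0" using n by (rule odd_pos)
  obtain m where m: "n = 2 * m + 1" using n by (elim oddE)
  obtain F G where "complex_of_int D =
    (\<Prod>z | z ^ (2 * n) = 1. ipoly F z * ipoly F (inverse z) - z ^ n * (ipoly G z * ipoly G (inverse z)))"
    by (rule int_group_dets_dicyclicE[OF n0 D(1)])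
  define P where "P = norm_form n 1 F G"
  define Q where "Q = norm_form n (- 1) (reflect F) (reflect G)"
  have symP: "ipoly P (inverse z) = ipoly P z" and symQ: "ipoly Q (inverse z) = ipoly Q z"
    if "z ^ n = 1" for z using that n0 by (simp_all add: P_def Q_def norm_form_inverse)
  have DPQ: "complex_of_int D = root_prod n P * root_prod n Q"
    using \<open>complex_of_int D = _\<close> by (simp add: dicyclic_product_split[OF n] P_def Q_def)
  obtain a where a: "(\<Prod>j<m. ipoly P (unity n ^ Suc j)) = of_int a" "root_prod n P = of_int (poly P 1 * a\<^sup>2)"
    using root_prod_Ints[OF m symP] by metis
  obtain b where b: "(\<Prod>j<m. ipoly Q (unity n ^ Suc j)) = of_int b" "root_prod n Q = of_int (poly Q 1 * b\<^sup>2)"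
    using root_prod_Ints[OF m symQ] by metis
  have Dab: "D = (poly P 1 * a\<^sup>2) * (poly Q 1 * b\<^sup>2)"
    using DPQ unfolding a(2) b(2) by (metis of_int_eq_iff of_int_mult)
  {
    assume "even D"
    have "even (b - a)"
      by (rule half_prod_mod_2[OF n0 _ b(1) a(1)]) (simp add: P_def Q_def norm_form_mod_2)
    then have "even (a - b)" by simp
    moreover have "D = ((poly F 1)\<^sup>2 - (poly G 1)\<^sup>2) * a\<^sup>2 * (((poly (reflect F) 1)\<^sup>2 + (poly (reflect G) 1)\<^sup>2) * b\<^sup>2)"
      using Dab by (simp add: P_def Q_def poly_norm_form_1)
    ultimately show "16 dvd D"
      using \<open>even D\<close>
      by (intro sixteen_dvd_of_even[OF _ even_poly_reflect_diff even_poly_reflect_diff])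
  }
  {
    assume p: "prime p" "odd p" "p dvd n" "int p dvd D"
    have nz: "poly P 1 * a\<^sup>2 \<noteq> 0" "poly Q 1 * b\<^sup>2 \<noteq> 0" using D Dab by auto
    have "int p dvd poly P 1 * a\<^sup>2 \<or> int p dvd poly Q 1 * b\<^sup>2"
      using p Dab by (metis prime_dvd_mult_iff prime_nat_int_transfer)
    then have "int p ^ 3 dvd poly P 1 * a\<^sup>2 \<or> int p ^ 3 dvd poly Q 1 * b\<^sup>2"
      using root_prod_prime_cube_dvd[OF p(1,2) n p(3) symP a(2) nz(1)]
        root_prod_prime_cube_dvd[OF p(1,2) n p(3) symQ b(2) nz(2)] by blast
    then show "int p ^ 3 dvd D" unfolding Dab by (meson dvd_mult dvd_mult2)
  }
qed

section \<open>Small determinants\<close>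

lemma norm_root_unity: "s ^ n = 1 \<Longrightarrow> n > 0 \<Longrightarrow> norm (s :: complex) = 1"
  by (rule power_eq_imp_eq_base[of _ n]) (simp_all add: norm_power[symmetric])

lemma power_coprime_eq_1_iff:
  fixes s :: complex
  assumes "n > 0" "coprime k n" "s ^ n = 1"
  shows "s ^ k = 1 \<longleftrightarrow> s = 1"
  using inj_on_eq_iff[OF bij_betw_imp_inj_on[OF bij_betw_power_roots_unity[OF assms(1,2)]], of s 1] assms(3)
  by simp

text \<open>Away from s = 1, \<open>\<phi>\<close> is the quotient g(s^k)/g(s), and s -> s^k
  permutes the roots, so these quotients cancel. The constant \<open>c\<close> allows a different
  value at s = 1, where the natural quotient may be 0/0.\<close>

lemma prod_roots_telescope:
  fixes \<phi> g :: "complex \<Rightarrow> real"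
  assumes n: "n > 0" and k: "coprime k n"
    and g: "\<And>s. s ^ n = 1 \<Longrightarrow> g s \<noteq> 0"
    and \<phi>: "\<And>s. s ^ n = 1 \<Longrightarrow> \<phi> s * g s = (if s = 1 then c else 1) * g (s ^ k)"
  shows "(\<Prod>s | s ^ n = 1. \<phi> s) = c"
proof -
  let ?R = "{s :: complex. s ^ n = 1}"
  have fin: "finite ?R" using bij_betw_finite[OF bij_betw_unity[OF n]] by simp
  have "(\<Prod>s\<in>?R. \<phi> s) * (\<Prod>s\<in>?R. g s) = (\<Prod>s\<in>?R. (if s = 1 then c else 1) * g (s ^ k))"
    unfolding prod.distrib[symmetric] by (rule prod.cong) (auto simp: \<phi>)
  also have "\<dots> = c * (\<Prod>s\<in>?R. g (s ^ k))"
    using fin by (simp add: prod.distrib)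
  also have "(\<Prod>s\<in>?R. g (s ^ k)) = (\<Prod>s\<in>?R. g s)"
    by (rule prod.reindex_bij_betw[OF bij_betw_power_roots_unity[OF n k]])
  finally show ?thesis using g fin by simp
qed

text \<open>The V of the opening comment; on the unit circle it is the Dirichlet kernel.\<close>

definition laurent_sum :: "nat \<Rightarrow> complex \<Rightarrow> complex" where
  "laurent_sum k s = 1 + (\<Sum>i = 1..k. s ^ i + inverse s ^ i)"

lemma laurent_sum_closed:
  assumes "s \<noteq> 0"
  shows "s ^ k * laurent_sum k s * (s - 1) = s ^ (2 * k + 1) - 1"
proof (induction k)
  case (Suc k)
  have L: "laurent_sum (Suc k) s = laurent_sum k s + s ^ Suc k + inverse s ^ Suc k"
    by (simp add: laurent_sum_def)
  have "s ^ Suc k * laurent_sum (Suc k) s * (s - 1)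
      = s * (s ^ k * laurent_sum k s * (s - 1)) + (s ^ Suc k * s ^ Suc k + s ^ Suc k * inverse s ^ Suc k) * (s - 1)"
    unfolding L by (simp add: algebra_simps)
  also have "s ^ Suc k * inverse s ^ Suc k = 1"
    using assms by (simp only: power_mult_distrib[symmetric]) simp
  also have "s * (s ^ k * laurent_sum k s * (s - 1)) + (s ^ Suc k * s ^ Suc k + 1) * (s - 1)
      = s ^ (2 * Suc k + 1) - 1"
    unfolding Suc.IH by (simp add: algebra_simps power_add mult_2 mult_2_right)
  finally show ?case .
qed (simp add: laurent_sum_def)

lemma norm_laurent_sum:
  assumes "norm s = 1"
  shows "norm (laurent_sum k s) * norm (s - 1) = norm (s ^ (2 * k + 1) - 1)"
proof -
  have "s \<noteq> 0" using assms by auto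
  from arg_cong[OF laurent_sum_closed[OF this, of k], of norm] show ?thesis
    using assms by (simp only: norm_mult norm_power power_one mult_1)
qed

lemma prod_laurent_sum:
  assumes n: "odd n" and k: "coprime (2 * k + 1) n"
  shows "(\<Prod>s | s ^ n = 1. norm (laurent_sum k s)) = 2 * k + 1"
    and "(\<Prod>s | s ^ n = 1. norm (laurent_sum k (- s))) = 1"
proof -
  have n0: "n > 0" using n by (rule odd_pos)
  show "(\<Prod>s | s ^ n = 1. norm (laurent_sum k s)) = 2 * k + 1"
  \<comment> \<open>The default 1 at s = 1 replaces the vanishing |s - 1|; there the factor is V(1)
    = 2k + 1.\<close>
  proof (rule prod_roots_telescope[OF n0 k, of "\<lambda>s. if s = 1 then 1 else norm (s - 1)"])
    fix s :: complex assume s: "s ^ n = 1"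
    show "norm (laurent_sum k s) * (if s = 1 then 1 else norm (s - 1))
        = (if s = 1 then real (2 * k + 1) else 1)
          * (if s ^ (2 * k + 1) = 1 then 1 else norm (s ^ (2 * k + 1) - 1))"
    proof (cases "s = 1")
      case True
      have "laurent_sum k 1 = of_nat (2 * k + 1)" by (simp add: laurent_sum_def)
      then show ?thesis using True by (simp only: norm_of_nat) simp
    next
      case False
      then show ?thesis
        using norm_laurent_sum[OF norm_root_unity[OF s n0], of k] power_coprime_eq_1_iff[OF n0 k s]
        by simp
    qed
  qed auto
  show "(\<Prod>s | s ^ n = 1. norm (laurent_sum k (- s))) = 1"
  \<comment> \<open>No exceptional root occurs here: -1 is not an n-th root of unity for odd
    n.\<close>
  proof (rule prod_roots_telescope[OF n0 k, of "\<lambda>s. norm (s + 1)"])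
    fix s :: complex assume s: "s ^ n = 1"
    show "norm (s + 1) \<noteq> 0" using s n by (auto simp: add_eq_0_iff2)
    have "norm (laurent_sum k (- s)) * norm (- s - 1) = norm ((- s) ^ (2 * k + 1) - 1)"
      using norm_root_unity[OF s n0] by (intro norm_laurent_sum) simp
    moreover have "norm (- s - 1) = norm (s + 1)" by (metis norm_minus_cancel minus_diff_eq minus_add_distrib uminus_add_conv_diff add.commute)
    moreover have "(- s) ^ (2 * k + 1) - 1 = - (s ^ (2 * k + 1) + 1)" by simp
    ultimately show "norm (laurent_sum k (- s)) * norm (s + 1) = (if s = 1 then 1 else 1) * norm (s ^ (2 * k + 1) + 1)"
      by (simp only: norm_minus_cancel) simp
  qed
qed

text \<open>With F = 1 + x^2 and G = 0, each s contributes |s^2 + 1|^4. Squaring permutes the roots,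
  so the product of |s^2 + 1| is that of |s + 1| = |s^2 - 1|/|s - 1|, which telescopes to the value
  2 at s = 1.\<close>

lemma dicyclic_det_16:
  assumes n: "odd n"
  shows "\<exists>D \<in> int_group_dets (dicyclic n). \<bar>D\<bar> = 16"
proof -
  have n0: "n > 0" using n by (rule odd_pos)
  let ?F = "[:1, 0, 1:] :: int poly"
  obtain D where D: "D \<in> int_group_dets (dicyclic n)" "complex_of_int D =
    (\<Prod>z | z ^ (2 * n) = 1. ipoly ?F z * ipoly ?F (inverse z) - z ^ n * (ipoly 0 z * ipoly 0 (inverse z)))"
    using int_group_dets_dicyclic_exists[OF n0, of ?F 0] by blast
  have cop: "coprime 2 n" using n by simp
  have "(\<Prod>s | s ^ n = 1. norm (s + (1 :: complex))) = 2"
  proof (rule prod_roots_telescope[OF n0 cop, of "\<lambda>s. if s = 1 then 1 else norm (s - 1)"])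
    fix s :: complex assume s: "s ^ n = 1"
    have "norm (s + 1) * norm (s - 1) = norm (s\<^sup>2 - 1)"
      by (simp add: norm_mult[symmetric] power2_eq_square algebra_simps)
    then show "norm (s + 1) * (if s = 1 then 1 else norm (s - 1))
        = (if s = 1 then 2 else 1) * (if s\<^sup>2 = 1 then 1 else norm (s\<^sup>2 - 1))"
      using power_coprime_eq_1_iff[OF n0 cop s] by auto
  qed auto
  then have two: "(\<Prod>s | s ^ n = 1. norm (s\<^sup>2 + (1 :: complex))) = 2"
    using prod.reindex_bij_betw[OF bij_betw_power_roots_unity[OF n0 cop], of "\<lambda>s. norm (s + 1)"] by simp
  have "complex_of_int D = (\<Prod>s | s ^ n = 1. (ipoly ?F s * ipoly ?F (inverse s)) * (ipoly ?F (- s) * ipoly ?F (inverse (- s))))"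
    using prod_roots_double[OF n, of "\<lambda>z. ipoly ?F z * ipoly ?F (inverse z)"] D(2) by simp
  then have "norm (complex_of_int D) = (\<Prod>s | s ^ n = 1. norm ((ipoly ?F s * ipoly ?F (inverse s)) * (ipoly ?F (- s) * ipoly ?F (inverse (- s)))))"
    by (simp only: prod_norm)
  also have "\<dots> = (\<Prod>s | s ^ n = 1. norm (s\<^sup>2 + (1 :: complex)) ^ 4)"
  proof (rule prod.cong[OF refl])
    fix s :: complex assume "s \<in> {s. s ^ n = 1}"
    then have s: "norm s = 1" using norm_root_unity n0 by simp
    then have s0: "s \<noteq> 0" by auto
    have "(inverse s)\<^sup>2 + 1 = (inverse s)\<^sup>2 * (s\<^sup>2 + 1)" using s0 by (simp add: field_simps power2_eq_square)
    then have i: "norm ((inverse s)\<^sup>2 + 1) = norm (s\<^sup>2 + 1)"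
      by (simp only: norm_mult norm_power norm_inverse s) simp
    have e: "ipoly ?F z = z\<^sup>2 + 1" for z by (simp add: power2_eq_square)
    have m: "inverse (- s) = - inverse s" by simp
    show "norm ((ipoly ?F s * ipoly ?F (inverse s)) * (ipoly ?F (- s) * ipoly ?F (inverse (- s)))) = norm (s\<^sup>2 + 1) ^ 4"
      unfolding e m power2_minus norm_mult i by (simp add: power4_eq_xxxx)
  qed
  also have "\<dots> = 16" unfolding prod_power_distrib[symmetric] two by simp
  finally have "\<bar>D\<bar> = 16" by simp
  with D(1) show ?thesis by blast
qed

text \<open>Write V(s) = b + (a + a'), where b collects the even exponents and a, a' the positive
  and negative odd ones; then V(-s) = b - (a + a'). The choice of F and G gives h(s) = b^2 - (a -
  a')^2 - 4aa' = V(s) V(-s) and h(-s) = V(-s)^2, and \<open>prod_laurent_sum\<close> evaluates the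
  product.\<close>

lemma dicyclic_det_coprime:
  assumes n: "odd n" and cop: "coprime (2 * k + 1) n"
  shows "\<exists>D \<in> int_group_dets (dicyclic n). \<bar>D\<bar> = 2 * int k + 1"
proof -
  have n0: "n > 0" using n by (rule odd_pos)
  define Od where "Od = {i \<in> {1..k}. odd i}"
  define Ev where "Ev = {i \<in> {1..k}. even i}"
  \<comment> \<open>With t = x^(n+1), which takes the value s at both z = s and z = -s, and t^(n-1) in place of 1/t:
    F is the sum of 1/t^i - x^n t^i over odd i minus the sum of t^i over even i in {-k..k},
    G is 1 + x^n times the sum of t^i over odd i in {1..k}.\<close>
  define F :: "int poly" where "F = (\<Sum>i\<in>Od. monom 1 ((n + 1) * ((n - 1) * i)) - monom 1 n * monom 1 ((n + 1) * i))
     - 1 - (\<Sum>i\<in>Ev. monom 1 ((n + 1) * i) + monom 1 ((n + 1) * ((n - 1) * i)))"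
  define G :: "int poly" where "G = (1 + monom 1 n) * (\<Sum>i\<in>Od. monom 1 ((n + 1) * i))"
  obtain D where D: "D \<in> int_group_dets (dicyclic n)" "complex_of_int D =
    (\<Prod>z | z ^ (2 * n) = 1. ipoly F z * ipoly F (inverse z) - z ^ n * (ipoly G z * ipoly G (inverse z)))"
    using int_group_dets_dicyclic_exists[OF n0, of F G] by blast
  let ?a = "\<lambda>s :: complex. \<Sum>i\<in>Od. s ^ i"
  let ?b = "\<lambda>s :: complex. 1 + (\<Sum>i\<in>Ev. s ^ i + inverse s ^ i)"
  have F: "ipoly F z = ?a (inverse s) - c * ?a s - ?b s"
    and G: "ipoly G z = (1 + c) * ?a s"
    if s: "s ^ n = 1" and z: "z ^ (n + 1) = s" "z ^ n = c" for s z c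
  proof -
    have t: "z ^ ((n + 1) * i) = s ^ i" "s ^ ((n - 1) * i) = inverse s ^ i" for i
      using z power_n_minus_1_root[OF s n0] by (simp_all only: power_mult)
    show "ipoly F z = ?a (inverse s) - c * ?a s - ?b s"
      unfolding F_def ipoly_sum ipoly_simps t z(2)
      by (simp add: ipoly_sum t z(2) sum_subtractf sum_distrib_left del: mult_Suc add_Suc_right)
    show "ipoly G z = (1 + c) * ?a s"
      unfolding G_def ipoly_sum ipoly_simps t z(2) by (simp add: ipoly_sum t z(2))
  qed
  have V: "laurent_sum k s = ?b s + (?a s + ?a (inverse s))"
    "laurent_sum k (- s) = ?b s - (?a s + ?a (inverse s))" for s
  proof -
    have U: "{1..k} = Ev \<union> Od" "Ev \<inter> Od = {}" "finite Ev" "finite Od" by (auto simp: Ev_def Od_def)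
    have "(\<Sum>i\<in>Ev. (- s) ^ i + inverse (- s) ^ i) = (\<Sum>i\<in>Ev. s ^ i + inverse s ^ i)"
      by (rule sum.cong) (auto simp: Ev_def)
    moreover have "(\<Sum>i\<in>Od. (- s) ^ i + inverse (- s) ^ i) = (\<Sum>i\<in>Od. - (s ^ i) - inverse s ^ i)"
      by (rule sum.cong) (auto simp: Od_def)
    ultimately show "laurent_sum k s = ?b s + (?a s + ?a (inverse s))"
      "laurent_sum k (- s) = ?b s - (?a s + ?a (inverse s))"
      unfolding laurent_sum_def U(1) sum.union_disjoint[OF U(3,4,2)]
      by (simp_all add: sum.distrib sum_subtractf sum_negf algebra_simps)
  qed
  have "complex_of_int D = (\<Prod>s | s ^ n = 1. laurent_sum k s * laurent_sum k (- s) ^ 3)"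
    unfolding D(2) prod_roots_double[OF n]
  proof (rule prod.cong[OF refl])
    fix s :: complex assume "s \<in> {s. s ^ n = 1}"
    then have s: "s ^ n = 1" "inverse s ^ n = 1" by (simp_all add: power_inverse)
    have p: "s ^ (n + 1) = s" "(- s) ^ (n + 1) = s" "(- s) ^ n = - 1"
      "inverse s ^ (n + 1) = inverse s" "inverse (- s) ^ (n + 1) = inverse s" "inverse (- s) ^ n = - 1"
      using s n by (simp_all add: power_inverse)
    have i: "?b (inverse s) = ?b s" "?a (inverse (inverse s)) = ?a s" by (simp_all add: add.commute)
    define a where "a = ?a s"
    define a' where "a' = ?a (inverse s)"
    define b where "b = ?b s"
    have e: "ipoly F s = a' - a - b" "ipoly F (inverse s) = a - a' - b"
      "ipoly F (- s) = a' + a - b" "ipoly F (inverse (- s)) = a + a' - b"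
      "ipoly G s = 2 * a" "ipoly G (inverse s) = 2 * a'" "ipoly G (- s) = 0"
      using F[OF s(1) p(1) s(1)] F[OF s(2) p(4) s(2)] F[OF s(1) p(2,3)] F[OF s(2) p(5,6)]
        G[OF s(1) p(1) s(1)] G[OF s(2) p(4) s(2)] G[OF s(1) p(2,3)]
      unfolding i by (simp_all add: a_def a'_def b_def)
    show "(ipoly F s * ipoly F (inverse s) - s ^ n * (ipoly G s * ipoly G (inverse s)))
       * (ipoly F (- s) * ipoly F (inverse (- s)) - (- s) ^ n * (ipoly G (- s) * ipoly G (inverse (- s))))
       = laurent_sum k s * laurent_sum k (- s) ^ 3"
      unfolding e V(1)[of s] V(2)[of s] a_def[symmetric] a'_def[symmetric] b_def[symmetric] s(1)
      by (simp add: algebra_simps power3_eq_cube)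
  qed
  then have "norm (complex_of_int D) = (\<Prod>s | s ^ n = 1. norm (laurent_sum k s)) * (\<Prod>s | s ^ n = 1. norm (laurent_sum k (- s))) ^ 3"
    by (simp only: prod_norm[symmetric] norm_mult norm_power prod.distrib prod_power_distrib)
  also have "\<dots> = real (2 * k + 1)" using prod_laurent_sum[OF n cop] by simp
  finally have "real_of_int \<bar>D\<bar> = real_of_int (2 * int k + 1)" by simp
  then have "\<bar>D\<bar> = 2 * int k + 1" by (simp only: of_int_eq_iff)
  with D(1) show ?thesis by blast
qed

section \<open>Computing the minimum\<close>

theorem theorem1:
  fixes n :: nat
  assumes "odd n" and "0 < n"
  shows "lambda_grp (dicyclic n) = min 16 (LEAST p::nat. prime p \<and> \<not> p dvd 2 * n)"
proof -
  let ?p = "LEAST p::nat. prime p \<and> \<not> p dvd 2 * n"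
  \<comment> \<open>Some prime does not divide 2n, so the \<open>LEAST\<close> is attained.\<close>
  obtain q where "prime q" "q > 2 * n" using bigger_prime by blast
  then have "prime q \<and> \<not> q dvd 2 * n" using assms by (auto dest: dvd_imp_le)
  then have p: "prime ?p" "\<not> ?p dvd 2 * n"
    using LeastI[of "\<lambda>p. prime p \<and> \<not> p dvd 2 * n" q] by auto
  have "odd ?p" using p by (metis dvd_mult2 dvd_refl prime_ge_2_nat primes_dvd_imp_eq two_is_prime_nat)
  then obtain k where k: "?p = 2 * k + 1" by (elim oddE)
  have "coprime ?p n" using p by (intro prime_imp_coprime) auto
  then have attained: "\<exists>D\<in>int_group_dets (dicyclic n). \<bar>D\<bar> = int ?p"
    using dicyclic_det_coprime[OF assms(1), of k] unfolding k by (simp add: add.commute)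
  show ?thesis
    unfolding lambda_grp_def
  proof (rule Least_equality)
    show "2 \<le> min 16 ?p \<and> (\<exists>D\<in>int_group_dets (dicyclic n). \<bar>D\<bar> = int (min 16 ?p))"
      using attained dicyclic_det_16[OF assms(1)] prime_ge_2_nat[OF p(1)] by (auto simp: min_def)
  next
    fix m :: nat assume "2 \<le> m \<and> (\<exists>D\<in>int_group_dets (dicyclic n). \<bar>D\<bar> = int m)"
    then obtain D where m: "2 \<le> m" and D: "D \<in> int_group_dets (dicyclic n)" "\<bar>D\<bar> = int m" by blast
    have D0: "D \<noteq> 0" using m D by auto
    have dvd: "int d dvd D \<longleftrightarrow> d dvd m" for d
      by (metis D(2) dvd_abs_iff int_dvd_int_iff)
    show "min 16 ?p \<le> m"
    proof (cases "even m")
      case True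
      then have "16 dvd m"
        using dicyclic_det_dvd(1)[OF assms(1) D(1) D0] dvd[of 2] dvd[of 16] by simp
      then show ?thesis using m by (auto dest: dvd_imp_le)
    next
      case False
      obtain r where r: "prime r" "r dvd m" using m prime_factor_nat[of m] by auto
      have "odd r" using r False by auto
      then have r3: "r \<ge> 3" using prime_ge_2_nat[OF r(1)] by (cases "r = 2") auto
      show ?thesis
      proof (cases "r dvd n")
        case True
        then have "int r ^ 3 dvd D"
          using dicyclic_det_dvd(2)[OF assms(1) D(1) D0 r(1) \<open>odd r\<close>] r(2) dvd[of r] by simp
        then have "r ^ 3 dvd m" using dvd[of "r ^ 3"] by simp
        then have "r ^ 3 \<le> m" using m by (auto dest: dvd_imp_le)
        \<comment> \<open>A prime factor of m that divides n makes m at least 27, beyond the bound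
          16.\<close>
        moreover have "(3 :: nat) ^ 3 \<le> r ^ 3" using r3 by (rule power_mono) simp
        ultimately show ?thesis by simp
      next
        case False
        then have "\<not> r dvd 2 * n"
          using r(1) \<open>odd r\<close> by (metis prime_dvd_mult_iff primes_dvd_imp_eq two_is_prime_nat dvd_refl)
        then have "?p \<le> r" using r(1) by (intro Least_le) simp
        moreover have "r \<le> m" using r(2) m by (auto dest: dvd_imp_le)
        ultimately show ?thesis by simp
      qed
    qed
  qed
qed

end
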